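(* Let $n=n_1+n_2+n_3$ and let $\boldsymbol{x}=[\boldsymbol q_h^\top\ \boldsymbol p_h^\top\ \boldsymbol x_{co}^\top\ \boldsymbol x_{\bar c\bar o}^\top]^\top$ satisfy the commutation relations $[\boldsymbol x,\boldsymbol x^\top]=\imath\bar{\mathbb J}_n$. Consider a Hamiltonian $\boldsymbol H=\frac12\boldsymbol x^\top H\boldsymbol x$ and a coupling operator $\boldsymbol L=\Gamma\boldsymbol x$, with $H\in\mathbb R^{2n\times 2n}$ and $\Gamma\in\mathbb C^{m\times 2n}$. Suppose that $H$ and $\Gamma$ have the block forms $$H=\begin{bmatrix} 0 & H_h^{12} & 0 & 0 \\ H_h^{12\top} & H_h^{22} & H_{12} & H_{13} \\ 0 & H_{12}^\top & H_{co} & 0 \\ 0 & H_{13}^\top & 0 & H_{\bar c\bar o} \end{bmatrix},\qquad \begin{bmatrix} \Gamma \\ \Gamma^{\#} \end{bmatrix}=\begin{bmatrix} 0 & \Gamma_h & \Gamma_{co} & 0 \end{bmatrix}\qquad(\ast)$$ and satisfy: (i) $H_h^{22}=H_h^{22\top}$, $H_{co}=H_{co}^\top$, $H_{\bar c\bar o}=H_{\bar c\bar o}^\top$; (ii) the pair $\left(\begin{bmatrix} \mathbb J_{n_1}H_{co} & \mathbb J_{n_1}H_{12}^\top \\ 0 & -H_h^{12} \end{bmatrix},\ \begin{bmatrix} \Gamma_{co} & \Gamma_h \end{bmatrix}\right)$ is observable. Then the QSDEs generated by $\boldsymbol H$ and $\boldsymbol L$ are in the Kalman canonical form; in other words, $\boldsymbol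 x_{co}$ is both controllable and observable, $\boldsymbol x_{\bar c\bar o}$ is neither controllable nor observable, $\boldsymbol q_h$ is controllable and unobservable, and $\boldsymbol p_h$ is uncontrollable and observable. Conversely, if $\boldsymbol H=\frac12\boldsymbol x^\top H\boldsymbol x$ ($H$ real symmetric) and $\boldsymbol L=\Gamma\boldsymbol x$ generate QSDEs in the Kalman canonical form, then $H$ and $\Gamma$ have the block forms $(\ast)$ and conditions (i)-(ii) hold.
   Context: Notation: $X^{\#}$ is the entrywise complex conjugate, $X^\dag=(X^{\#})^\top$; $J_k=\mathrm{diag}(I_k,-I_k)$; $\mathbb J_k=\begin{bmatrix} 0 & I_k \\ -I_k & 0 \end{bmatrix}$; $\bar{\mathbb J}_n=\mathrm{diag}(\mathbb J_{n_3},\mathbb J_{n_1},\mathbb J_{n_2})$; $V_k=\frac1{\sqrt2}\begin{bmatrix} I_k & I_k \\ -\imath I_k & \imath I_k \end{bmatrix}$; $\breve\Gamma=\begin{bmatrix} \Gamma \\ \Gamma^{\#} \end{bmatrix}$. The blocks $\boldsymbol q_h,\boldsymbol p_h,\boldsymbol x_{co},\boldsymbol x_{\bar c\bar o}$ have lengths $n_3,n_3,2n_1,2n_2$, and all block matrices are partitioned accordingly. QSDEs generated by $(H,\Gamma)$ ($H$ real symmetric): $\dot{\boldsymbol x}=\bar A\boldsymbol x+\bar B\boldsymbol u$, $\boldsymbol y=\bar C\boldsymbol x+\boldsymbol u$ with the (real) matrices $\bar A=\bar{\mathbb J}_nH-\frac{\imath}{2}\bar{\mathbb J}_n\breve\Gamma^\dag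 J_m\breve\Gamma$, $\bar B=\bar{\mathbb J}_n\breve\Gamma^\dag V_m^\dag\mathbb J_m$, $\bar C=V_m\breve\Gamma$, where $\boldsymbol u,\boldsymbol y$ are the $2m$-vectors of input/output field quadratures. Kalman canonical form: the system is in Kalman canonical form if $$\bar A=\begin{bmatrix} A_h^{11} & A_h^{12} & A_{12} & A_{13} \\ 0 & A_h^{22} & 0 & 0 \\ 0 & A_{21} & A_{co} & 0 \\ 0 & A_{31} & 0 & A_{\bar c\bar o} \end{bmatrix},\quad \bar B=\begin{bmatrix} B_h \\ 0 \\ B_{co} \\ 0 \end{bmatrix},\quad \bar C=\begin{bmatrix} 0 & C_h & C_{co} & 0 \end{bmatrix},$$ and the controllable subspace of $(\bar A,\bar B)$ (range of the controllability matrix) is exactly the coordinate subspace of the $\boldsymbol q_h$ and $\boldsymbol x_{co}$ coordinates, and the unobservable subspace of $(\bar A,\bar C)$ (kernel of the observability matrix) is exactly the coordinate subspace of the $\boldsymbol q_h$ and $\boldsymbol x_{\bar c\bar o}$ coordinates. This is the meaning of "$\boldsymbol x_{co}$ is controllable and observable, $\boldsymbol x_{\bar c\bar o}$ neither, $\boldsymbol q_h$ controllable and unobservable, $\boldsymbol p_h$ uncontrollable and observable". *)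

theory Defs
  imports
    "Jordan_Normal_Form.Matrix_Kernel"
    "Jordan_Normal_Form.Schur_Decomposition"
begin

definition append_cols :: "'a :: zero mat \<Rightarrow> 'a mat \<Rightarrow> 'a mat" (infixr \<open>@\<^sub>c\<close> 66) where
  "A @\<^sub>c B = four_block_mat A B (0\<^sub>m 0 (dim_col A)) (0\<^sub>m 0 (dim_col B))"

text \<open>Since \<open>@\<^sub>c\<close> binds tighter than \<open>@\<^sub>r\<close>, a block matrix is written row by row. Like
  \<^const>\<open>four_block_mat\<close>, both operators take the sizes from the blocks themselves, so every use
  below comes with the dimensions of all blocks.\<close>

abbreviation cmat :: "real mat \<Rightarrow> complex mat" where
  "cmat \<equiv> map_mat complex_of_real"

lemma mat_adjoint_conj_transpose: "mat_adjoint X = (map_mat cnj X)\<^sup>T"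
  by (rule eq_matI) (auto simp: mat_adjoint_def mat_of_rows_def)


definition observability_matrix :: "'a :: comm_ring_1 mat \<Rightarrow> 'a mat \<Rightarrow> 'a mat" where
  "observability_matrix A C =
     foldr (@\<^sub>r) (map (\<lambda>k. C * A ^\<^sub>m k) [0..<dim_row A]) (0\<^sub>m 0 (dim_row A))"

definition controllability_matrix :: "'a :: comm_ring_1 mat \<Rightarrow> 'a mat \<Rightarrow> 'a mat" where
  "controllability_matrix A B =
     foldr (@\<^sub>c) (map (\<lambda>k. A ^\<^sub>m k * B) [0..<dim_row A]) (0\<^sub>m (dim_row A) 0)"

definition unobservable_subspace :: "'a :: comm_ring_1 mat \<Rightarrow> 'a mat \<Rightarrow> 'a vec set" where
  "unobservable_subspace A C = mat_kernel (observability_matrix A C)"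

definition controllable_subspace :: "'a :: comm_ring_1 mat \<Rightarrow> 'a mat \<Rightarrow> 'a vec set" where
  "controllable_subspace A B =
     (let K = controllability_matrix A B in (\<lambda>v. K *\<^sub>v v) ` carrier_vec (dim_col K))"

definition observable_pair :: "'a :: comm_ring_1 mat \<Rightarrow> 'a mat \<Rightarrow> bool" where
  "observable_pair A C \<longleftrightarrow> unobservable_subspace A C = {0\<^sub>v (dim_row A)}"


definition J_mat :: "nat \<Rightarrow> complex mat" where
  "J_mat k = four_block_mat (1\<^sub>m k) (0\<^sub>m k k) (0\<^sub>m k k) (- 1\<^sub>m k)"

definition JJ :: "nat \<Rightarrow> complex mat" where
  "JJ k = four_block_mat (0\<^sub>m k k) (1\<^sub>m k) (- 1\<^sub>m k) (0\<^sub>m k k)"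

definition JJ_bar :: "nat \<Rightarrow> nat \<Rightarrow> nat \<Rightarrow> complex mat" where
  "JJ_bar n1 n2 n3 = diag_block_mat [JJ n3, JJ n1, JJ n2]"

definition V_mat :: "nat \<Rightarrow> complex mat" where
  "V_mat k = complex_of_real (1 / sqrt 2) \<cdot>\<^sub>m
     four_block_mat (1\<^sub>m k) (1\<^sub>m k) ((- \<i>) \<cdot>\<^sub>m 1\<^sub>m k) (\<i> \<cdot>\<^sub>m 1\<^sub>m k)"

definition doubled :: "complex mat \<Rightarrow> complex mat" where
  "doubled \<Gamma> = \<Gamma> @\<^sub>r map_mat cnj \<Gamma>"

text \<open>Coefficient matrices of the QSDEs \<open>dx/dt = A x + B u\<close>, \<open>y = C x + u\<close> generated by the
  Hamiltonian \<open>x\<^sup>T H x / 2\<close> and the coupling operator \<open>\<Gamma> x\<close>, where the operators \<open>x\<close> satisfy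
  \<open>[x, x\<^sup>T] = \<i> JJ_bar\<close>; the commutation relations enter only through \<open>JJ_bar\<close>. For real
  symmetric \<open>H\<close> the entries of these matrices are real; they are kept as complex matrices, and
  controllable and unobservable subspaces are taken over the complex numbers (they are the
  complexifications of the real ones).\<close>

definition qsde_A :: "nat \<Rightarrow> nat \<Rightarrow> nat \<Rightarrow> nat \<Rightarrow> real mat \<Rightarrow> complex mat \<Rightarrow> complex mat" where
  "qsde_A n1 n2 n3 m H \<Gamma> =
     JJ_bar n1 n2 n3 * cmat H
     - (\<i> / 2) \<cdot>\<^sub>m (JJ_bar n1 n2 n3 * mat_adjoint (doubled \<Gamma>) * J_mat m * doubled \<Gamma>)"

definition qsde_B :: "nat \<Rightarrow> nat \<Rightarrow> nat \<Rightarrow> nat \<Rightarrow> complex mat \<Rightarrow> complex mat" where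
  "qsde_B n1 n2 n3 m \<Gamma> =
     JJ_bar n1 n2 n3 * mat_adjoint (doubled \<Gamma>) * mat_adjoint (V_mat m) * JJ m"

definition qsde_C :: "nat \<Rightarrow> complex mat \<Rightarrow> complex mat" where
  "qsde_C m \<Gamma> = V_mat m * doubled \<Gamma>"


text \<open>Index sets of the blocks of \<open>x = (q_h, p_h, x_co, x_cc)\<close>, of lengths
  \<open>n3, n3, 2 n1, 2 n2\<close>; \<open>cc\<close> stands for the neither controllable nor observable part.
  Controllability or observability of a block is read off from the last two conjuncts of
  \<open>kalman_canonical_form\<close>.\<close>

definition idx_qh :: "nat \<Rightarrow> nat set" where
  "idx_qh n3 = {0..<n3}"

definition idx_co :: "nat \<Rightarrow> nat \<Rightarrow> nat set" where
  "idx_co n1 n3 = {2 * n3..<2 * n3 + 2 * n1}"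

definition idx_cc :: "nat \<Rightarrow> nat \<Rightarrow> nat \<Rightarrow> nat set" where
  "idx_cc n1 n2 n3 = {2 * n3 + 2 * n1..<2 * n3 + 2 * n1 + 2 * n2}"

definition coord_subspace :: "nat \<Rightarrow> nat set \<Rightarrow> complex vec set" where
  "coord_subspace N I = {v \<in> carrier_vec N. \<forall>i<N. i \<notin> I \<longrightarrow> v $ i = 0}"

definition kalman_canonical_form ::
  "nat \<Rightarrow> nat \<Rightarrow> nat \<Rightarrow> nat \<Rightarrow> complex mat \<Rightarrow> complex mat \<Rightarrow> complex mat \<Rightarrow> bool" where
  "kalman_canonical_form n1 n2 n3 m A B C \<longleftrightarrow>
     (\<exists>Ah11 Ah12 A12 A13 Ah22 A21 Aco A31 Acc Bh Bco Ch Cco.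
        Ah11 \<in> carrier_mat n3 n3 \<and> Ah12 \<in> carrier_mat n3 n3 \<and>
        A12 \<in> carrier_mat n3 (2 * n1) \<and> A13 \<in> carrier_mat n3 (2 * n2) \<and>
        Ah22 \<in> carrier_mat n3 n3 \<and>
        A21 \<in> carrier_mat (2 * n1) n3 \<and> Aco \<in> carrier_mat (2 * n1) (2 * n1) \<and>
        A31 \<in> carrier_mat (2 * n2) n3 \<and> Acc \<in> carrier_mat (2 * n2) (2 * n2) \<and>
        Bh \<in> carrier_mat n3 (2 * m) \<and> Bco \<in> carrier_mat (2 * n1) (2 * m) \<and>
        Ch \<in> carrier_mat (2 * m) n3 \<and> Cco \<in> carrier_mat (2 * m) (2 * n1) \<and>
        A = Ah11                @\<^sub>c Ah12 @\<^sub>c A12                      @\<^sub>c A13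
         @\<^sub>r 0\<^sub>m n3 n3           @\<^sub>c Ah22 @\<^sub>c 0\<^sub>m n3 (2 * n1)         @\<^sub>c 0\<^sub>m n3 (2 * n2)
         @\<^sub>r 0\<^sub>m (2 * n1) n3     @\<^sub>c A21  @\<^sub>c Aco                      @\<^sub>c 0\<^sub>m (2 * n1) (2 * n2)
         @\<^sub>r 0\<^sub>m (2 * n2) n3     @\<^sub>c A31  @\<^sub>c 0\<^sub>m (2 * n2) (2 * n1)   @\<^sub>c Acc \<and>
        B = Bh @\<^sub>r 0\<^sub>m n3 (2 * m) @\<^sub>r Bco @\<^sub>r 0\<^sub>m (2 * n2) (2 * m) \<and>
        C = 0\<^sub>m (2 * m) n3 @\<^sub>c Ch @\<^sub>c Cco @\<^sub>c 0\<^sub>m (2 * m) (2 * n2)) \<and>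
     controllable_subspace A B =
       coord_subspace (2 * (n1 + n2 + n3)) (idx_qh n3 \<union> idx_co n1 n3) \<and>
     unobservable_subspace A C =
       coord_subspace (2 * (n1 + n2 + n3)) (idx_qh n3 \<union> idx_cc n1 n2 n3)"

definition hamiltonian_coupling_block_form ::
  "nat \<Rightarrow> nat \<Rightarrow> nat \<Rightarrow> nat \<Rightarrow> real mat \<Rightarrow> complex mat \<Rightarrow>
   real mat \<Rightarrow> real mat \<Rightarrow> real mat \<Rightarrow> real mat \<Rightarrow> real mat \<Rightarrow> real mat \<Rightarrow>
   complex mat \<Rightarrow> complex mat \<Rightarrow> bool" where
  "hamiltonian_coupling_block_form n1 n2 n3 m H \<Gamma> Hh12 Hh22 H12 H13 Hco Hcc \<Gamma>h \<Gamma>co \<longleftrightarrow>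
     Hh12 \<in> carrier_mat n3 n3 \<and> Hh22 \<in> carrier_mat n3 n3 \<and>
     H12 \<in> carrier_mat n3 (2 * n1) \<and> H13 \<in> carrier_mat n3 (2 * n2) \<and>
     Hco \<in> carrier_mat (2 * n1) (2 * n1) \<and> Hcc \<in> carrier_mat (2 * n2) (2 * n2) \<and>
     \<Gamma>h \<in> carrier_mat (2 * m) n3 \<and> \<Gamma>co \<in> carrier_mat (2 * m) (2 * n1) \<and>
     H = 0\<^sub>m n3 n3         @\<^sub>c Hh12  @\<^sub>c 0\<^sub>m n3 (2 * n1)         @\<^sub>c 0\<^sub>m n3 (2 * n2)
      @\<^sub>r Hh12\<^sup>T            @\<^sub>c Hh22  @\<^sub>c H12                      @\<^sub>c H13
      @\<^sub>r 0\<^sub>m (2 * n1) n3   @\<^sub>c H12\<^sup>T  @\<^sub>c Hco                      @\<^sub>c 0\<^sub>m (2 * n1) (2 * n2)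
      @\<^sub>r 0\<^sub>m (2 * n2) n3   @\<^sub>c H13\<^sup>T  @\<^sub>c 0\<^sub>m (2 * n2) (2 * n1)   @\<^sub>c Hcc \<and>
     doubled \<Gamma> = 0\<^sub>m (2 * m) n3 @\<^sub>c \<Gamma>h @\<^sub>c \<Gamma>co @\<^sub>c 0\<^sub>m (2 * m) (2 * n2)"

end

theory Submission
  imports Defs
begin

text \<open>Write \<open>J = JJ_bar\<close>, \<open>C = V \<Gamma>\<close> (with the doubled \<open>\<Gamma>\<close>). Since \<open>V\<close> is unitary and
  \<open>V\<^sup>\<dagger> JJ V = - \<i> J_mat\<close>, one has \<open>B = J C\<^sup>\<dagger> JJ\<close> and \<open>A = J H + B C / 2\<close>. Output injection
  removes the last term, so the unobservable subspace of \<open>(A, C)\<close> is that of \<open>(J H, \<Gamma>)\<close>; for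
  Hamiltonians of the given shape, restricting to the coordinates \<open>x_co\<close>, \<open>p_h\<close> intertwines this pair
  with the pair of condition (ii). Moreover \<open>A\<^sup>\<dagger>\<close>, \<open>B\<^sup>\<dagger>\<close> have the same structure with \<open>H J\<close> and
  \<open>C J\<close> in place of \<open>J H\<close> and \<open>C\<close>, so \<open>J\<close> maps the orthogonal complement of the controllable
  subspace onto the unobservable subspace, and the controllability requirement of the canonical form
  follows from the observability one. The zero patterns of \<open>H\<close> and \<open>A\<close> correspond because \<open>J\<close> is a
  signed permutation exchanging \<open>q_h\<close> with \<open>p_h\<close>.\<close>

section \<open>Unobservable subspaces\<close>

text \<open>Condition (ii) speaks of \<open>J H\<close> and not of \<open>A\<close>, so output
  injection has to precede the restriction to coordinates. It is easy once the unobservable subspace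
  is known as the largest invariant set inside the kernel of \<open>C\<close>. The definition,
  however, stacks only n powers, while invariance also asks for the power n; linear dependence of n
  + 1 Krylov vectors supplies it. The controllable subspace is a range, not a kernel, and is reached
  through the kernel of the adjoint. This works because \<open>H\<close> is real symmetric,
  \<open>J\<close> is real and skew-symmetric, and \<open>JJ m\<close> is unitary. Both directions
  of the theorem are read off one equivalence for symmetric \<open>H\<close>, whose conjuncts must
  be settled in a fixed order: the pattern of \<open>C\<close> gives that of \<open>B\<close>, and
  only with both at hand does \<open>B C\<close> stay within the blocks that \<open>A\<close> may
  fill, so that the drift pattern becomes a condition on \<open>H\<close> alone. The sign of
  \<open>- Hh12\<close> in (ii) is that of the \<open>p_h\<close> rows of \<open>J\<close>, which
  return minus the \<open>q_h\<close> rows of \<open>H\<close>.\<close>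

lemma dim_append_rows [simp]:
  "dim_row (A @\<^sub>r B) = dim_row A + dim_row B"
  "dim_col (A @\<^sub>r B) = dim_col A"
  by (simp_all add: append_rows_def)

lemma dim_append_cols [simp]:
  "dim_row (A @\<^sub>c B) = dim_row A"
  "dim_col (A @\<^sub>c B) = dim_col A + dim_col B"
  by (simp_all add: append_cols_def)

lemma index_append_rows:
  "i < dim_row A + dim_row B \<Longrightarrow> j < dim_col A \<Longrightarrow>
    (A @\<^sub>r B) $$ (i, j) = (if i < dim_row A then A $$ (i, j) else B $$ (i - dim_row A, j))"
  by (simp add: append_rows_def)

lemma index_append_cols:
  "i < dim_row A \<Longrightarrow> j < dim_col A + dim_col B \<Longrightarrow>
    (A @\<^sub>c B) $$ (i, j) = (if j < dim_col A then A $$ (i, j) else B $$ (i, j - dim_col A))"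
  by (simp add: append_cols_def)

lemma mult_mat_vec_zero [simp]:
  "A \<in> carrier_mat nr nc \<Longrightarrow> A *\<^sub>v 0\<^sub>v nc = 0\<^sub>v nr"
  by (intro eq_vecI) auto

lemma foldr_append_rows_carrier:
  assumes "\<forall>M \<in> set Ms. dim_col M = n"
  shows "foldr (@\<^sub>r) Ms (0\<^sub>m 0 n) \<in> carrier_mat (sum_list (map dim_row Ms)) n"
  using assms by (induction Ms) (auto intro!: carrier_append_rows)

lemma foldr_append_rows_mult_eq_0:
  assumes "\<forall>M \<in> set Ms. dim_col M = n" "v \<in> carrier_vec n"
  shows "foldr (@\<^sub>r) Ms (0\<^sub>m 0 n) *\<^sub>v v = 0\<^sub>v (sum_list (map dim_row Ms))
    \<longleftrightarrow> (\<forall>M \<in> set Ms. M *\<^sub>v v = 0\<^sub>v (dim_row M))"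
  using assms(1)
proof (induction Ms)
  case (Cons M Ms)
  let ?F = "foldr (@\<^sub>r) Ms (0\<^sub>m 0 n)"
  have F: "?F \<in> carrier_mat (sum_list (map dim_row Ms)) n"
    using Cons.prems by (intro foldr_append_rows_carrier) auto
  have M: "M \<in> carrier_mat (dim_row M) n"
    using Cons.prems by (intro carrier_matI) auto
  have split: "0\<^sub>v (dim_row M + s) = 0\<^sub>v (dim_row M) @\<^sub>v 0\<^sub>v s" for s
    by auto
  have mult: "(M @\<^sub>r ?F) *\<^sub>v v = (M *\<^sub>v v) @\<^sub>v (?F *\<^sub>v v)"
    by (rule mat_mult_append[OF M F assms(2)])
  have "(M @\<^sub>r ?F) *\<^sub>v v = 0\<^sub>v (dim_row M + sum_list (map dim_row Ms))
      \<longleftrightarrow> M *\<^sub>v v = 0\<^sub>v (dim_row M) \<and> ?F *\<^sub>v v = 0\<^sub>v (sum_list (map dim_row Ms))"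
    unfolding mult split by (rule append_vec_eq[OF mult_mat_vec_carrier[OF M assms(2)] zero_carrier_vec])
  then show ?case
    using Cons by simp
qed auto

lemma observability_matrix_carrier:
  assumes "A \<in> carrier_mat n n" "C \<in> carrier_mat p n"
  shows "observability_matrix A C \<in> carrier_mat (n * p) n"
proof -
  have "observability_matrix A C
      \<in> carrier_mat (sum_list (map dim_row (map (\<lambda>k. C * A ^\<^sub>m k) [0..<n]))) n"
    unfolding observability_matrix_def using assms
    by (simp del: map_map) (intro foldr_append_rows_carrier, auto)
  then show ?thesis
    using assms by (simp add: o_def sum_list_triv)
qed

lemma unobservable_subspace_powers:
  assumes "A \<in> carrier_mat n n" "C \<in> carrier_mat p n"
  shows "unobservable_subspace A C
    = {v \<in> carrier_vec n. \<forall>k<n. C * A ^\<^sub>m k *\<^sub>v v = 0\<^sub>v p}"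
proof -
  let ?Ms = "map (\<lambda>k. C * A ^\<^sub>m k) [0..<n]"
  have Ms: "\<forall>M \<in> set ?Ms. dim_col M = n"
    using assms by auto
  have O: "observability_matrix A C = foldr (@\<^sub>r) ?Ms (0\<^sub>m 0 n)"
    using assms by (simp add: observability_matrix_def)
  have "v \<in> unobservable_subspace A C \<longleftrightarrow>
      v \<in> carrier_vec n \<and> (\<forall>k<n. C * A ^\<^sub>m k *\<^sub>v v = 0\<^sub>v p)" for v
    using mat_kernel[OF foldr_append_rows_carrier[OF Ms]] foldr_append_rows_mult_eq_0[OF Ms, of v]
      assms
    by (auto simp: unobservable_subspace_def O simp del: map_map)
  then show ?thesis
    by auto
qed

section \<open>From the first n powers to all powers\<close>

lemma pow_mat_add_mult_vec:
  assumes "A \<in> carrier_mat n n" "v \<in> carrier_vec n"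
  shows "A ^\<^sub>m (k + l) *\<^sub>v v = A ^\<^sub>m k *\<^sub>v (A ^\<^sub>m l *\<^sub>v v)"
  using assms(2)
proof (induction l arbitrary: v)
  case 0
  then show ?case using assms by auto
next
  case (Suc l)
  have "A ^\<^sub>m (k + Suc l) *\<^sub>v v = A ^\<^sub>m (k + l) *\<^sub>v (A *\<^sub>v v)"
    using assms(1) Suc.prems by (simp add: assoc_mult_mat_vec[of _ n n _ n])
  also have "\<dots> = A ^\<^sub>m k *\<^sub>v (A ^\<^sub>m l *\<^sub>v (A *\<^sub>v v))"
    using assms(1) Suc.prems by (intro Suc.IH) auto
  also have "\<dots> = A ^\<^sub>m k *\<^sub>v (A ^\<^sub>m Suc l *\<^sub>v v)"
    using assms(1) Suc.prems by (simp add: assoc_mult_mat_vec[of _ n n _ n])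
  finally show ?case .
qed

text \<open>The n + 1 vectors \<open>A ^\<^sub>m j *\<^sub>v v\<close> with j \<le> n live in
  dimension n. The relation obtained depends on \<open>v\<close>, which is enough here and avoids
  the characteristic polynomial.\<close>

lemma krylov_dependent:
  fixes A :: "'a :: field mat"
  assumes A: "A \<in> carrier_mat n n" and v: "v \<in> carrier_vec n"
  obtains c q where "q \<le> n" "c q \<noteq> 0" "\<And>i. i < n \<Longrightarrow> (\<Sum>j\<le>q. c j * (A ^\<^sub>m j *\<^sub>v v) $ i) = 0"
proof -
  \<comment> \<open>A zero row pads the n by n + 1 Krylov matrix to a square one; its determinant
    vanishes, which yields a kernel vector of coefficients.\<close>
  define M where "M = mat (Suc n) (Suc n) (\<lambda>(i, j). if i < n then (A ^\<^sub>m j *\<^sub>v v) $ i else 0)"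
  have M: "M \<in> carrier_mat (Suc n) (Suc n)"
    by (simp add: M_def)
  have "mat\<^sub>r (Suc n) (Suc n) (\<lambda>i. if i = n then 0\<^sub>v (Suc n) else row M i) = M"
    by (intro eq_matI) (auto simp: M_def)
  then have "det M = 0"
    using det_row_0[of n "Suc n" "row M"] M by simp
  then obtain w where w: "w \<in> carrier_vec (Suc n)" "w \<noteq> 0\<^sub>v (Suc n)" "M *\<^sub>v w = 0\<^sub>v (Suc n)"
    using det_0_iff_vec_prod_zero[OF M] by auto
  \<comment> \<open>Cutting the relation at the largest index with a nonzero coefficient makes the
    last Krylov vector a combination of the earlier ones.\<close>
  let ?S = "{j. j \<le> n \<and> w $ j \<noteq> 0}"
  have "?S \<noteq> {}"
    using w(1,2) by (auto simp: vec_eq_iff less_Suc_eq_le)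
  then have q: "Max ?S \<in> ?S"
    by (intro Max_in) auto
  have large: "w $ j = 0" if "j > Max ?S" "j \<le> n" for j
    using that Max_ge[of ?S j] by fastforce
  show ?thesis
  proof (rule that[of "Max ?S" "\<lambda>j. w $ j"])
    fix i assume i: "i < n"
    have "0 = (M *\<^sub>v w) $ i"
      using w(3) i by simp
    also have "\<dots> = (\<Sum>j<Suc n. w $ j * (A ^\<^sub>m j *\<^sub>v v) $ i)"
      using i w(1) by (auto simp: M_def scalar_prod_def atLeast0LessThan mult.commute simp del: sum.lessThan_Suc intro!: sum.cong)
    also have "\<dots> = (\<Sum>j\<le>Max ?S. w $ j * (A ^\<^sub>m j *\<^sub>v v) $ i)"
    proof (intro sum.mono_neutral_right ballI)
      show "{..Max ?S} \<subseteq> {..<Suc n}"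
        using q by auto
      show "w $ j * (A ^\<^sub>m j *\<^sub>v v) $ i = 0" if "j \<in> {..<Suc n} - {..Max ?S}" for j
        using large[of j] that by simp
    qed simp
    finally show "(\<Sum>j\<le>Max ?S. w $ j * (A ^\<^sub>m j *\<^sub>v v) $ i) = 0"
      by simp
  qed (use q in auto)
qed

text \<open>Applying \<open>C * A ^\<^sub>m d\<close> to the Krylov relation of length q \<le> n
  expresses the output at power d + q by the outputs at the q preceding powers. Powers below q are
  covered by the definition, larger ones by strong induction.\<close>

lemma unobservable_subspace_all_powers:
  fixes A :: "'a :: field mat"
  assumes A: "A \<in> carrier_mat n n" and C: "C \<in> carrier_mat p n"
    and v: "v \<in> unobservable_subspace A C"
  shows "C *\<^sub>v (A ^\<^sub>m k *\<^sub>v v) = 0\<^sub>v p"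
proof -
  have vc: "v \<in> carrier_vec n" and small: "\<And>k. k < n \<Longrightarrow> C *\<^sub>v (A ^\<^sub>m k *\<^sub>v v) = 0\<^sub>v p"
    using v A C by (auto simp: unobservable_subspace_powers[OF A C] assoc_mult_mat_vec[of _ p n _ n])
  obtain c q where q: "q \<le> n" "c q \<noteq> 0"
    and dep: "\<And>i. i < n \<Longrightarrow> (\<Sum>j\<le>q. c j * (A ^\<^sub>m j *\<^sub>v v) $ i) = 0"
    using krylov_dependent[OF A vc] by metis
  show ?thesis
  proof (induction k rule: less_induct)
    case (less k)
    show ?case
    proof (cases "k < q")
      case True
      then show ?thesis using q small by auto
    next
      case False
      define d where "d = k - q"
      have k: "k = d + q"
        using False by (simp add: d_def)
      show ?thesis
      proof (rule eq_vecI)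
        fix r assume "r < dim_vec (0\<^sub>v p)"
        then have r: "r < p" by simp
        let ?w = "row (C * A ^\<^sub>m d) r"
        have f: "(C *\<^sub>v (A ^\<^sub>m (d + j) *\<^sub>v v)) $ r = (\<Sum>i<n. ?w $ i * (A ^\<^sub>m j *\<^sub>v v) $ i)" for j
        proof -
          have "C *\<^sub>v (A ^\<^sub>m (d + j) *\<^sub>v v) = C * A ^\<^sub>m d *\<^sub>v (A ^\<^sub>m j *\<^sub>v v)"
            using assoc_mult_mat_vec[OF C pow_carrier_mat[OF A]
                mult_mat_vec_carrier[OF pow_carrier_mat[OF A] vc], of d j]
            by (simp add: pow_mat_add_mult_vec[OF A vc])
          also have "\<dots> $ r = ?w \<bullet> (A ^\<^sub>m j *\<^sub>v v)"
            using r C by simp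
          finally show ?thesis
            using A vc by (simp add: scalar_prod_def atLeast0LessThan del: row_mult)
        qed
        let ?f = "\<lambda>j. c j * (C *\<^sub>v (A ^\<^sub>m (d + j) *\<^sub>v v)) $ r"
        have "sum ?f {..q}
            = (\<Sum>j\<le>q. \<Sum>i<n. ?w $ i * (c j * (A ^\<^sub>m j *\<^sub>v v) $ i))"
          unfolding f by (simp add: sum_distrib_left mult.left_commute)
        also have "\<dots> = (\<Sum>i<n. ?w $ i * (\<Sum>j\<le>q. c j * (A ^\<^sub>m j *\<^sub>v v) $ i))"
          by (subst sum.swap) (simp add: sum_distrib_left)
        also have "\<dots> = 0"
          using dep by simp
        finally have "sum ?f {..<Suc q} = 0"
          by (simp only: lessThan_Suc_atMost)
        \<comment> \<open>These summands belong to powers d + j < k, where the induction hypothesis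
          applies.\<close>
        moreover have "sum ?f {..<q} = 0"
          using less r unfolding k by (intro sum.neutral) simp
        ultimately have "?f q = 0"
          unfolding sum.lessThan_Suc by simp
        then show "(C *\<^sub>v (A ^\<^sub>m k *\<^sub>v v)) $ r = 0\<^sub>v p $ r"
          using q(2) r unfolding k by simp
      qed (use C in auto)
    qed
  qed
qed

section \<open>The unobservable subspace as the largest invariant set in the kernel of the
  output\<close>

lemma unobservable_subspace_carrier:
  assumes "A \<in> carrier_mat n n" "C \<in> carrier_mat p n"
  shows "unobservable_subspace A C \<subseteq> carrier_vec n"
  using assms by (auto simp: unobservable_subspace_powers)

lemma unobservable_subspace_output:
  fixes A :: "'a :: field mat"
  assumes "A \<in> carrier_mat n n" "C \<in> carrier_mat p n" "v \<in> unobservable_subspace A C"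
  shows "C *\<^sub>v v = 0\<^sub>v p"
proof -
  have "v \<in> carrier_vec n"
    using assms unobservable_subspace_carrier by blast
  then show ?thesis
    using unobservable_subspace_all_powers[OF assms, of 0] assms(1) by simp
qed

text \<open>Shifting by \<open>A\<close> asks for one power beyond those in the observability
  matrix, which \<open>unobservable_subspace_all_powers\<close> provides.\<close>

lemma unobservable_subspace_invariant:
  fixes A :: "'a :: field mat"
  assumes A: "A \<in> carrier_mat n n" and C: "C \<in> carrier_mat p n"
    and v: "v \<in> unobservable_subspace A C"
  shows "A *\<^sub>v v \<in> unobservable_subspace A C"
proof -
  have vc: "v \<in> carrier_vec n"
    using assms unobservable_subspace_carrier by blast
  have "C * A ^\<^sub>m k *\<^sub>v (A *\<^sub>v v) = 0\<^sub>v p" for k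
    using unobservable_subspace_all_powers[OF assms, of "Suc k"] A C vc
    by (simp add: assoc_mult_mat_vec[of _ p n _ n] assoc_mult_mat_vec[of _ n n _ n])
  then show ?thesis
    using A C vc by (simp add: unobservable_subspace_powers)
qed

text \<open>An orbit that starts in an invariant set inside the kernel of \<open>C\<close> never
  produces an output. \<open>X\<close> is a mere set of vectors, so images and preimages under
  linear maps can be inserted directly.\<close>

lemma unobservable_subspace_coinduct:
  assumes A: "A \<in> carrier_mat n n" and C: "C \<in> carrier_mat p n"
    and v: "v \<in> X" and X: "X \<subseteq> carrier_vec n"
    and inv: "\<And>w. w \<in> X \<Longrightarrow> A *\<^sub>v w \<in> X" and out: "\<And>w. w \<in> X \<Longrightarrow> C *\<^sub>v w = 0\<^sub>v p"
  shows "v \<in> unobservable_subspace A C"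
proof -
  have "A ^\<^sub>m k *\<^sub>v w \<in> X" if "w \<in> X" for k w
    using that
  proof (induction k arbitrary: w)
    case 0
    then show ?case using A X by auto
  next
    case (Suc k)
    have "A ^\<^sub>m Suc k *\<^sub>v w = A ^\<^sub>m k *\<^sub>v (A *\<^sub>v w)"
      using A X Suc.prems by (auto simp: assoc_mult_mat_vec[of _ n n _ n])
    then show ?case using Suc inv by simp
  qed
  then have "C *\<^sub>v (A ^\<^sub>m k *\<^sub>v v) = 0\<^sub>v p" for k
    using v out by blast
  then show ?thesis
    using A C v X by (auto simp: unobservable_subspace_powers assoc_mult_mat_vec[of _ p n _ n])
qed

lemma unobservable_subspace_smult:
  fixes A :: "'a :: field mat"
  assumes A: "A \<in> carrier_mat n n" and C: "C \<in> carrier_mat p n"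
    and v: "v \<in> unobservable_subspace A C"
  shows "c \<cdot>\<^sub>v v \<in> unobservable_subspace A C"
  using mat_kernel_smult[OF observability_matrix_carrier[OF A C]] v
  unfolding unobservable_subspace_def by blast

text \<open>Where \<open>C\<close> vanishes, the added term \<open>L * C\<close> does nothing and
  the new drift acts as \<open>c\<close> times \<open>A\<close>. The factor \<open>c\<close> is
  there for the adjoint system, whose Hamiltonian part comes with the sign -1.\<close>

lemma unobservable_subspace_output_injection:
  fixes A :: "'a :: field mat"
  assumes A: "A \<in> carrier_mat n n" and C: "C \<in> carrier_mat p n" and L: "L \<in> carrier_mat n p"
    and c: "c \<noteq> 0"
  shows "unobservable_subspace (c \<cdot>\<^sub>m A + L * C) C = unobservable_subspace A C"
proof -
  have sub: "unobservable_subspace A C \<subseteq> unobservable_subspace (c \<cdot>\<^sub>m A + L * C) C"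
    if A: "A \<in> carrier_mat n n" and L: "L \<in> carrier_mat n p" for A L and c :: 'a
  proof
    fix v assume v: "v \<in> unobservable_subspace A C"
    have "(c \<cdot>\<^sub>m A + L * C) *\<^sub>v w \<in> unobservable_subspace A C" if w: "w \<in> unobservable_subspace A C" for w
    proof -
      have wc: "w \<in> carrier_vec n"
        using w unobservable_subspace_carrier[OF A C] by blast
      have "(c \<cdot>\<^sub>m A + L * C) *\<^sub>v w = c \<cdot>\<^sub>v (A *\<^sub>v w) + L *\<^sub>v (C *\<^sub>v w)"
        using A C L wc by (intro eq_vecI) (auto simp: add_mult_distrib_mat_vec[of _ n n] assoc_mult_mat_vec[of _ n p _ n])
      also have "\<dots> = c \<cdot>\<^sub>v (A *\<^sub>v w)"
        using unobservable_subspace_output[OF A C w] A L wc by simp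
      finally show ?thesis
        using unobservable_subspace_smult[OF A C unobservable_subspace_invariant[OF A C w]] by simp
    qed
    then show "v \<in> unobservable_subspace (c \<cdot>\<^sub>m A + L * C) C"
      using A L C v unobservable_subspace_carrier[OF A C] unobservable_subspace_output[OF A C]
      by (rule_tac unobservable_subspace_coinduct[OF _ C, where X = "unobservable_subspace A C"])
        simp_all
  qed
  let ?A = "c \<cdot>\<^sub>m A + L * C"
  \<comment> \<open>The construction is undone by another output injection, with factor 1 / c and
    gain - (1 / c) times \<open>L\<close>; the inclusion already shown therefore also gives the
    reverse one.\<close>
  have inv: "(1 / c) \<cdot>\<^sub>m ?A + (- (1 / c) \<cdot>\<^sub>m L) * C = A"
    unfolding mult_smult_assoc_mat[OF L C]
    using A C L c by (intro eq_matI) (auto simp: distrib_left)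
  have "unobservable_subspace ?A C
      \<subseteq> unobservable_subspace ((1 / c) \<cdot>\<^sub>m ?A + (- (1 / c) \<cdot>\<^sub>m L) * C) C"
    using A C L by (intro sub) auto
  then show ?thesis
    unfolding inv using sub[OF A L, of c] by (rule subset_antisym)
qed

text \<open>A matrix with a left inverse neither creates nor loses zero outputs. This removes
  \<open>V_mat\<close> from the output, and a unitary factor from the output of the adjoint
  system.\<close>

lemma unobservable_subspace_left_inverse:
  fixes A :: "'a :: field mat"
  assumes A: "A \<in> carrier_mat n n" and C: "C \<in> carrier_mat p n"
    and W: "W \<in> carrier_mat q p" "W' \<in> carrier_mat p q" "W' * W = 1\<^sub>m p"
  shows "unobservable_subspace A (W * C) = unobservable_subspace A C"
proof -
  have WC: "W * C \<in> carrier_mat q n"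
    using W C by simp
  have C': "C = W' * (W * C)"
    unfolding assoc_mult_mat[OF W(2,1) C, symmetric] W(3) left_mult_one_mat[OF C] ..
  have "v \<in> unobservable_subspace A (W * C)" if "v \<in> unobservable_subspace A C" for v
  proof (rule unobservable_subspace_coinduct[where X = "unobservable_subspace A C", OF A WC that])
    fix w assume w: "w \<in> unobservable_subspace A C"
    have wc: "w \<in> carrier_vec n"
      using w unobservable_subspace_carrier[OF A C] by blast
    show "W * C *\<^sub>v w = 0\<^sub>v q"
      using unobservable_subspace_output[OF A C w] W assoc_mult_mat_vec[OF W(1) C wc] by simp
  qed (rule unobservable_subspace_carrier[OF A C] unobservable_subspace_invariant[OF A C]; assumption)+
  moreover have "v \<in> unobservable_subspace A C" if "v \<in> unobservable_subspace A (W * C)" for v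
  proof (rule unobservable_subspace_coinduct[where X = "unobservable_subspace A (W * C)", OF A C that])
    fix w assume w: "w \<in> unobservable_subspace A (W * C)"
    have wc: "w \<in> carrier_vec n"
      using w unobservable_subspace_carrier[OF A WC] by blast
    have "C *\<^sub>v w = W' *\<^sub>v (W * C *\<^sub>v w)"
      using assoc_mult_mat_vec[OF W(2) WC wc] unfolding C'[symmetric] .
    then show "C *\<^sub>v w = 0\<^sub>v p"
      using unobservable_subspace_output[OF A WC w] W by simp
  qed (rule unobservable_subspace_carrier[OF A WC] unobservable_subspace_invariant[OF A WC]; assumption)+
  ultimately show ?thesis by blast
qed

text \<open>\<open>S\<close> carries trajectories of the first system to trajectories of the second
  with equal outputs, so images and preimages of invariant sets under \<open>S\<close> are
  invariant. It is used with \<open>S\<close> the matrix \<open>J\<close>, and with \<open>S\<close>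
  the selection of the \<open>x_co\<close> and \<open>p_h\<close> coordinates.\<close>

lemma unobservable_subspace_intertwining:
  fixes A :: "'a :: field mat"
  assumes A: "A \<in> carrier_mat n n" and C: "C \<in> carrier_mat p n"
    and A': "A' \<in> carrier_mat n' n'" and C': "C' \<in> carrier_mat p n'"
    and S: "S \<in> carrier_mat n' n" and SA: "S * A = A' * S" and SC: "C = C' * S"
  shows "unobservable_subspace A C = {v \<in> carrier_vec n. S *\<^sub>v v \<in> unobservable_subspace A' C'}"
proof -
  have act: "S *\<^sub>v (A *\<^sub>v v) = A' *\<^sub>v (S *\<^sub>v v)" if "v \<in> carrier_vec n" for v
    using that A A' S SA by (metis assoc_mult_mat_vec)
  have out: "C *\<^sub>v v = C' *\<^sub>v (S *\<^sub>v v)" if "v \<in> carrier_vec n" for v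
    unfolding SC using that C' S by (metis assoc_mult_mat_vec)
  have "S *\<^sub>v v \<in> unobservable_subspace A' C'" if v: "v \<in> unobservable_subspace A C" for v
  proof (rule unobservable_subspace_coinduct[OF A' C', where X = "(*\<^sub>v) S ` unobservable_subspace A C"])
    fix w assume "w \<in> (*\<^sub>v) S ` unobservable_subspace A C"
    then obtain u where u: "u \<in> unobservable_subspace A C" "w = S *\<^sub>v u"
      by auto
    then have uc: "u \<in> carrier_vec n"
      using unobservable_subspace_carrier[OF A C] by blast
    show "A' *\<^sub>v w \<in> (*\<^sub>v) S ` unobservable_subspace A C"
      using unobservable_subspace_invariant[OF A C u(1)] by (simp add: u(2) act[OF uc, symmetric])
    show "C' *\<^sub>v w = 0\<^sub>v p"
      using out[OF uc] u unobservable_subspace_output[OF A C u(1)] by simp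
  qed (use v S unobservable_subspace_carrier[OF A C] in auto)
  moreover have "v \<in> unobservable_subspace A C"
    if v: "v \<in> carrier_vec n" "S *\<^sub>v v \<in> unobservable_subspace A' C'" for v
  proof (rule unobservable_subspace_coinduct[OF A C,
        where X = "{v \<in> carrier_vec n. S *\<^sub>v v \<in> unobservable_subspace A' C'}"])
    fix w assume "w \<in> {v \<in> carrier_vec n. S *\<^sub>v v \<in> unobservable_subspace A' C'}"
    then have w: "w \<in> carrier_vec n" "S *\<^sub>v w \<in> unobservable_subspace A' C'"
      by auto
    show "A *\<^sub>v w \<in> {v \<in> carrier_vec n. S *\<^sub>v v \<in> unobservable_subspace A' C'}"
      using A w unobservable_subspace_invariant[OF A' C' w(2)] by (simp add: act)
    show "C *\<^sub>v w = 0\<^sub>v p"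
      using unobservable_subspace_output[OF A' C' w(2)] out[OF w(1)] by simp
  qed (use v in auto)
  ultimately show ?thesis
    using unobservable_subspace_carrier[OF A C] by blast
qed

section \<open>Adjoints and controllability\<close>

lemma dim_mat_adjoint [simp]:
  fixes A :: "complex mat"
  shows "dim_row (mat_adjoint A) = dim_col A" "dim_col (mat_adjoint A) = dim_row A"
  by (simp_all add: mat_adjoint_conj_transpose)

lemma mat_adjoint_carrier [simp]:
  fixes A :: "complex mat"
  shows "A \<in> carrier_mat n m \<Longrightarrow> mat_adjoint A \<in> carrier_mat m n"
  by (auto simp: mat_adjoint_conj_transpose)

lemma index_mat_adjoint [simp]:
  "i < dim_col A \<Longrightarrow> j < dim_row A \<Longrightarrow> mat_adjoint A $$ (i, j) = cnj (A $$ (j, i))"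
  by (simp add: mat_adjoint_conj_transpose)

lemma mat_adjoint_mult:
  fixes A B :: "complex mat"
  assumes "A \<in> carrier_mat n m" "B \<in> carrier_mat m p"
  shows "mat_adjoint (A * B) = mat_adjoint B * mat_adjoint A"
  using assms by (intro eq_matI) (auto simp: scalar_prod_def mult.commute)

lemma mat_adjoint_add:
  fixes A B :: "complex mat"
  assumes "A \<in> carrier_mat n m" "B \<in> carrier_mat n m"
  shows "mat_adjoint (A + B) = mat_adjoint A + mat_adjoint B"
  using assms by (intro eq_matI) auto

lemma mat_adjoint_smult:
  "mat_adjoint (c \<cdot>\<^sub>m A) = cnj c \<cdot>\<^sub>m mat_adjoint A"
  by (intro eq_matI) auto

lemma mat_adjoint_one: "mat_adjoint (1\<^sub>m n :: complex mat) = 1\<^sub>m n"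
  by (intro eq_matI) auto

lemma mat_adjoint_adjoint: "mat_adjoint (mat_adjoint A) = (A :: complex mat)"
  by (intro eq_matI) auto

lemma pow_mat_Suc_left:
  assumes "A \<in> carrier_mat n n"
  shows "A ^\<^sub>m Suc k = A * A ^\<^sub>m k"
proof (induction k)
  case (Suc k)
  have "A ^\<^sub>m Suc (Suc k) = (A * A ^\<^sub>m k) * A"
    using Suc by simp
  also have "\<dots> = A * A ^\<^sub>m Suc k"
    using assms by (simp add: assoc_mult_mat[OF assms pow_carrier_mat[OF assms] assms])
  finally show ?case .
qed (use assms in auto)

lemma mat_adjoint_pow:
  fixes A :: "complex mat"
  assumes A: "A \<in> carrier_mat n n"
  shows "mat_adjoint (A ^\<^sub>m k) = mat_adjoint A ^\<^sub>m k"
proof (induction k)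
  case 0
  then show ?case using assms by (simp add: mat_adjoint_one)
next
  case (Suc k)
  have "mat_adjoint (A ^\<^sub>m Suc k) = mat_adjoint A * mat_adjoint A ^\<^sub>m k"
    using Suc mat_adjoint_mult[OF pow_carrier_mat[OF A] A, of k] by simp
  then show ?case
    using pow_mat_Suc_left[OF mat_adjoint_carrier[OF A], of k] by simp
qed

lemma mat_adjoint_append_cols:
  fixes A B :: "complex mat"
  assumes "dim_row A = dim_row B"
  shows "mat_adjoint (A @\<^sub>c B) = mat_adjoint A @\<^sub>r mat_adjoint B"
  using assms by (intro eq_matI) (auto simp: index_append_rows index_append_cols)

lemma dim_row_foldr_append_cols:
  assumes "\<forall>M \<in> set Ms. dim_row M = n"
  shows "dim_row (foldr (@\<^sub>c) Ms (0\<^sub>m n 0)) = n"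
  using assms by (induction Ms) auto

lemma mat_adjoint_foldr_append_cols:
  fixes Ms :: "complex mat list"
  assumes "\<forall>M \<in> set Ms. dim_row M = n"
  shows "mat_adjoint (foldr (@\<^sub>c) Ms (0\<^sub>m n 0)) = foldr (@\<^sub>r) (map mat_adjoint Ms) (0\<^sub>m 0 n)"
  using assms
proof (induction Ms)
  case Nil
  show ?case by (intro eq_matI) auto
qed (simp add: mat_adjoint_append_cols dim_row_foldr_append_cols)

text \<open>Taking adjoints turns the columns \<open>A ^\<^sub>m k * B\<close> into rows with the
  factors reversed, which is exactly an observability matrix.\<close>

lemma mat_adjoint_controllability_matrix:
  fixes A B :: "complex mat"
  assumes A: "A \<in> carrier_mat n n" and B: "B \<in> carrier_mat n p"
  shows "mat_adjoint (controllability_matrix A B)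
    = observability_matrix (mat_adjoint A) (mat_adjoint B)"
proof -
  let ?Ms = "map (\<lambda>k. A ^\<^sub>m k * B) [0..<n]"
  have "mat_adjoint (A ^\<^sub>m k * B) = mat_adjoint B * mat_adjoint A ^\<^sub>m k" for k
    using mat_adjoint_mult[OF pow_carrier_mat[OF A] B] mat_adjoint_pow[OF A] by simp
  then have "foldr (@\<^sub>r) (map mat_adjoint ?Ms) (0\<^sub>m 0 n)
      = observability_matrix (mat_adjoint A) (mat_adjoint B)"
    using A by (simp add: observability_matrix_def o_def)
  moreover have "\<forall>M \<in> set ?Ms. dim_row M = n"
    using A by auto
  ultimately show ?thesis
    using A mat_adjoint_foldr_append_cols[of ?Ms n] by (simp add: controllability_matrix_def)
qed

section \<open>From the kernel of the adjoint to the range\<close>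

lemma scalar_prod_mat_adjoint:
  fixes K :: "complex mat"
  assumes "K \<in> carrier_mat n q" "u \<in> carrier_vec q" "w \<in> carrier_vec n"
  shows "(K *\<^sub>v u) \<bullet>c w = u \<bullet>c (mat_adjoint K *\<^sub>v w)"
proof -
  have "(K *\<^sub>v u) \<bullet>c w = (\<Sum>i<n. \<Sum>k<q. K $$ (i, k) * u $ k * cnj (w $ i))"
    using assms by (auto simp: scalar_prod_def atLeast0LessThan sum_distrib_right intro!: sum.cong)
  also have "\<dots> = (\<Sum>k<q. \<Sum>i<n. u $ k * cnj (cnj (K $$ (i, k)) * w $ i))"
    by (subst sum.swap) (simp add: ac_simps)
  also have "\<dots> = u \<bullet>c (mat_adjoint K *\<^sub>v w)"
    using assms by (auto simp: scalar_prod_def atLeast0LessThan sum_distrib_left intro!: sum.cong)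
  finally show ?thesis .
qed

lemma nonsingular_mult_vec_surj:
  fixes M :: "'a :: field mat"
  assumes M: "M \<in> carrier_mat n n"
    and inj: "\<And>w. w \<in> carrier_vec n \<Longrightarrow> M *\<^sub>v w = 0\<^sub>v n \<Longrightarrow> w = 0\<^sub>v n"
    and v: "v \<in> carrier_vec n"
  obtains w where "w \<in> carrier_vec n" "M *\<^sub>v w = v"
proof -
  have "det M \<noteq> 0"
    using det_0_iff_vec_prod_zero_field[OF M] inj by blast
  then obtain N where N: "N \<in> carrier_mat n n" "M * N = 1\<^sub>m n"
    using det_non_zero_imp_unit[OF M, of "()"] by (auto simp: Units_def ring_mat_def)
  have "M *\<^sub>v (N *\<^sub>v v) = v"
    using assoc_mult_mat_vec[OF M N(1) v] v unfolding N(2) by simp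
  then show ?thesis
    using that[of "N *\<^sub>v v"] N(1) v by auto
qed

text \<open>The matrix \<open>K K\<^sup>\<dagger> + P\<close>, with \<open>P\<close> the projection onto the coordinates outside \<open>I\<close>, is
  nonsingular, and solving with it represents any vector supported on \<open>I\<close> as \<open>K (K\<^sup>\<dagger> w)\<close>.\<close>

lemma range_eq_coord_subspace_of_adjoint_kernel:
  assumes K: "K \<in> carrier_mat n q"
    and ker: "mat_kernel (mat_adjoint K) = coord_subspace n (- I)"
  shows "(\<lambda>u. K *\<^sub>v u) ` carrier_vec q = coord_subspace n I"
proof -
  let ?K = "mat_adjoint K"
  have K': "?K \<in> carrier_mat q n"
    using K by simp
  \<comment> \<open>For i outside \<open>I\<close> the unit vector lies in the kernel of the
    adjoint, so row i of \<open>K\<close> is zero; this already places the range inside the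
    coordinate subspace.\<close>
  have row0: "(K *\<^sub>v u) $ i = 0" if "i < n" "i \<notin> I" "u \<in> carrier_vec q" for i u
  proof -
    have "unit_vec n i \<in> mat_kernel ?K"
      unfolding ker using that by (auto simp: coord_subspace_def)
    then have e: "?K *\<^sub>v unit_vec n i = 0\<^sub>v q"
      using mat_kernelD[OF K'] by blast
    have "K $$ (i, k) = 0" if "k < q" for k
    proof -
      have "(?K *\<^sub>v unit_vec n i) $ k = ?K $$ (k, i)"
        using K \<open>i < n\<close> that by simp
      then show ?thesis
        using e K \<open>i < n\<close> that by simp
    qed
    then show ?thesis
      using K that by (simp add: scalar_prod_def)
  qed
  define P where "P = mat n n (\<lambda>(i, j). if i = j \<and> i \<notin> I then 1 else 0 :: complex)"
  have P: "P \<in> carrier_mat n n"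
    by (simp add: P_def)
  have Pw: "(P *\<^sub>v w) $ i = (if i \<in> I then 0 else w $ i)" if "i < n" "w \<in> carrier_vec n" for i w
    using that by (auto simp: P_def scalar_prod_def atLeast0LessThan if_distrib[of "\<lambda>x. x * _"] cong: if_cong)
  let ?M = "K * ?K + P"
  have M: "?M \<in> carrier_mat n n"
    using K P by auto
  have Mw: "?M *\<^sub>v w = K *\<^sub>v (?K *\<^sub>v w) + P *\<^sub>v w" if "w \<in> carrier_vec n" for w
    using add_mult_distrib_mat_vec[OF mult_carrier_mat[OF K K'] P that]
      assoc_mult_mat_vec[OF K K' that] by simp
  have inj: "w = 0\<^sub>v n" if w: "w \<in> carrier_vec n" and 0: "?M *\<^sub>v w = 0\<^sub>v n" for w
  proof -
    have Kw: "?K *\<^sub>v w \<in> carrier_vec q"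
      by (rule mult_mat_vec_carrier[OF K' w])
    have KKw: "K *\<^sub>v (?K *\<^sub>v w) \<in> carrier_vec n"
      by (rule mult_mat_vec_carrier[OF K Kw])
    have PPw: "P *\<^sub>v w \<in> carrier_vec n"
      using P w by auto
    \<comment> \<open>\<open>P\<close> is an orthogonal projection, so the quadratic form of
      \<open>?M\<close> at \<open>w\<close> is a sum of two squared norms, and both vanish on the
      kernel of \<open>?M\<close>.\<close>
    have "(P *\<^sub>v w) \<bullet>c w = (P *\<^sub>v w) \<bullet>c (P *\<^sub>v w)"
      using w P Pw by (auto simp: scalar_prod_def intro!: sum.cong)
    moreover have "(?M *\<^sub>v w) \<bullet>c w = (K *\<^sub>v (?K *\<^sub>v w)) \<bullet>c w + (P *\<^sub>v w) \<bullet>c w"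
      unfolding Mw[OF w] using w KKw PPw by (intro add_scalar_prod_distrib) auto
    moreover have "(?M *\<^sub>v w) \<bullet>c w = 0"
      unfolding 0 using w by simp
    ultimately have "(?K *\<^sub>v w) \<bullet>c (?K *\<^sub>v w) + (P *\<^sub>v w) \<bullet>c (P *\<^sub>v w) = 0"
      using scalar_prod_mat_adjoint[OF K Kw w] by simp
    then have "(?K *\<^sub>v w) \<bullet>c (?K *\<^sub>v w) = 0" "(P *\<^sub>v w) \<bullet>c (P *\<^sub>v w) = 0"
      using conjugate_square_ge_0_vec[of "?K *\<^sub>v w"] conjugate_square_ge_0_vec[of "P *\<^sub>v w"]
      by (simp_all add: add_nonneg_eq_0_iff)
    then have Kw0: "?K *\<^sub>v w = 0\<^sub>v q" and "P *\<^sub>v w = 0\<^sub>v n"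
      using conjugate_square_eq_0_vec[OF Kw] conjugate_square_eq_0_vec[OF PPw] by auto
    \<comment> \<open>\<open>P\<close> controls the entries of \<open>w\<close> outside
      \<open>I\<close>, the kernel of the adjoint those inside.\<close>
    then have "w $ i = 0" if "i < n" "i \<notin> I" for i
      using Pw[OF that(1) w] that by simp
    moreover have "w \<in> coord_subspace n (- I)"
      unfolding ker[symmetric] using mat_kernelI[OF K' w Kw0] .
    ultimately show ?thesis
      using w by (intro eq_vecI) (auto simp: coord_subspace_def)
  qed
  show ?thesis
  proof (intro equalityI subsetI)
    fix v assume "v \<in> (\<lambda>u. K *\<^sub>v u) ` carrier_vec q"
    then show "v \<in> coord_subspace n I"
      using K row0 by (auto simp: coord_subspace_def)
  next
    fix v assume v: "v \<in> coord_subspace n I"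
    then have "v \<in> carrier_vec n"
      by (simp add: coord_subspace_def)
    then obtain w where w: "w \<in> carrier_vec n" "?M *\<^sub>v w = v"
      using nonsingular_mult_vec_surj[OF M inj] by blast
    have Kw: "?K *\<^sub>v w \<in> carrier_vec q"
      by (rule mult_mat_vec_carrier[OF K' w(1)])
    have "(P *\<^sub>v w) $ i = 0" if i: "i < n" for i
    proof (cases "i \<in> I")
      case False
      have "v $ i = (K *\<^sub>v (?K *\<^sub>v w)) $ i + (P *\<^sub>v w) $ i"
        using i K P w(1) unfolding w(2)[symmetric] Mw[OF w(1)] by simp
      then show ?thesis
        using v False i row0[OF i False Kw] by (simp add: coord_subspace_def)
    qed (use Pw[OF i w(1)] in simp)
    then have "P *\<^sub>v w = 0\<^sub>v n"
      using P by (intro eq_vecI) auto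
    then have "v = K *\<^sub>v (?K *\<^sub>v w)"
      using w(2) K Kw unfolding Mw[OF w(1)] by (metis mult_mat_vec_carrier right_zero_vec)
    then show "v \<in> (\<lambda>u. K *\<^sub>v u) ` carrier_vec q"
      using Kw by blast
  qed
qed

lemma controllability_matrix_carrier:
  fixes A B :: "complex mat"
  assumes A: "A \<in> carrier_mat n n" and B: "B \<in> carrier_mat n p"
  shows "controllability_matrix A B \<in> carrier_mat n (n * p)"
  using observability_matrix_carrier[OF mat_adjoint_carrier[OF A] mat_adjoint_carrier[OF B]]
  unfolding mat_adjoint_controllability_matrix[OF assms, symmetric]
  by (metis mat_adjoint_adjoint mat_adjoint_carrier)

lemma controllable_subspace_eq_coord_subspace:
  assumes A: "A \<in> carrier_mat n n" and B: "B \<in> carrier_mat n p"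
    and "unobservable_subspace (mat_adjoint A) (mat_adjoint B) = coord_subspace n (- I)"
  shows "controllable_subspace A B = coord_subspace n I"
proof -
  have "mat_kernel (mat_adjoint (controllability_matrix A B)) = coord_subspace n (- I)"
    using assms(3) unfolding unobservable_subspace_def mat_adjoint_controllability_matrix[OF A B] .
  from range_eq_coord_subspace_of_adjoint_kernel[OF controllability_matrix_carrier[OF A B] this]
  show ?thesis
    using controllability_matrix_carrier[OF A B] by (simp add: controllable_subspace_def)
qed

text \<open>The duality behind the theorem: up to \<open>J\<close>, being annihilated by the controllability matrix
  is the same as being unobservable.\<close>

lemma unobservable_subspace_adjoint:
  fixes J H C W :: "complex mat"
  assumes J: "J \<in> carrier_mat n n" "mat_adjoint J = - J"
    and H: "H \<in> carrier_mat n n" "mat_adjoint H = H"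
    and C: "C \<in> carrier_mat p n" and W: "W \<in> carrier_mat p p" "W * mat_adjoint W = 1\<^sub>m p"
  defines "B \<equiv> J * mat_adjoint C * W"
  defines "A \<equiv> J * H + (1 / 2) \<cdot>\<^sub>m (B * C)"
  shows "unobservable_subspace A C = unobservable_subspace (J * H) C"
    and "unobservable_subspace (mat_adjoint A) (mat_adjoint B)
      = {w \<in> carrier_vec n. J *\<^sub>v w \<in> unobservable_subspace A C}"
proof -
  have B: "B \<in> carrier_mat n p"
    unfolding B_def using J(1) C W(1) by (intro mult_carrier_mat mat_adjoint_carrier)
  have JH: "J * H \<in> carrier_mat n n" and HJ: "H * J \<in> carrier_mat n n" and CJ: "C * J \<in> carrier_mat p n"
    using J H C by auto
  have one_smult: "1 \<cdot>\<^sub>m X = X" and neg_smult: "(- 1) \<cdot>\<^sub>m ((- 1) \<cdot>\<^sub>m X) = X" for X :: "complex mat"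
    by (auto intro!: eq_matI)
  have "A = 1 \<cdot>\<^sub>m (J * H) + ((1 / 2) \<cdot>\<^sub>m B) * C"
    unfolding A_def mult_smult_assoc_mat[OF B C] one_smult ..
  then show *: "unobservable_subspace A C = unobservable_subspace (J * H) C"
    using unobservable_subspace_output_injection[OF JH C, of "(1 / 2) \<cdot>\<^sub>m B" 1] B by simp
  have negJ: "- J = (- 1) \<cdot>\<^sub>m J"
    by (intro eq_matI) auto
  \<comment> \<open>Skewness of \<open>J\<close> turns the adjoint of \<open>B\<close> into
    \<open>C J\<close>, up to the invertible factor - \<open>W\<^sup>\<dagger>\<close> on the
    left.\<close>
  have "mat_adjoint B = mat_adjoint W * (C * mat_adjoint J)"
    unfolding B_def using J(1) C W(1)
    by (simp add: mat_adjoint_mult[of _ n p _ p] mat_adjoint_mult[of _ n n _ p] mat_adjoint_adjoint)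
  also have "\<dots> = ((- 1) \<cdot>\<^sub>m mat_adjoint W) * (C * J)"
    unfolding J(2) negJ mult_smult_distrib[OF C J(1)]
    using mult_smult_distrib[OF mat_adjoint_carrier[OF W(1)] CJ]
      mult_smult_assoc_mat[OF mat_adjoint_carrier[OF W(1)] CJ] by simp
  finally have B': "mat_adjoint B = ((- 1) \<cdot>\<^sub>m mat_adjoint W) * (C * J)" .
  have "mat_adjoint (J * H) = (- 1) \<cdot>\<^sub>m (H * J)"
    unfolding mat_adjoint_mult[OF J(1) H(1)] H(2) J(2) negJ mult_smult_distrib[OF H(1) J(1)] ..
  moreover have "mat_adjoint ((1 / 2) \<cdot>\<^sub>m (B * C)) = ((1 / 2) \<cdot>\<^sub>m mat_adjoint C) * mat_adjoint B"
    unfolding mat_adjoint_smult mat_adjoint_mult[OF B C]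
      mult_smult_assoc_mat[OF mat_adjoint_carrier[OF C] mat_adjoint_carrier[OF B]] by simp
  ultimately have A': "mat_adjoint A
      = (- 1) \<cdot>\<^sub>m (H * J) + ((1 / 2) \<cdot>\<^sub>m mat_adjoint C) * mat_adjoint B"
    unfolding A_def
    by (subst mat_adjoint_add[OF JH]) (use B C in auto)
  \<comment> \<open>Output injection again, now with factor -1, drift \<open>H J\<close>, output
    \<open>B\<^sup>\<dagger>\<close> and gain \<open>C\<^sup>\<dagger>\<close> / 2.\<close>
  have "unobservable_subspace (mat_adjoint A) (mat_adjoint B)
      = unobservable_subspace (H * J) (mat_adjoint B)"
    unfolding A' using B C HJ
    by (intro unobservable_subspace_output_injection) auto
  also have "\<dots> = unobservable_subspace (H * J) (C * J)"
    unfolding B'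
  proof (rule unobservable_subspace_left_inverse[OF HJ CJ])
    show "((- 1) \<cdot>\<^sub>m W) * ((- 1) \<cdot>\<^sub>m mat_adjoint W) = 1\<^sub>m p"
      unfolding mult_smult_assoc_mat[OF W(1) smult_carrier_mat[OF mat_adjoint_carrier[OF W(1)]]]
        mult_smult_distrib[OF W(1) mat_adjoint_carrier[OF W(1)]] W(2) neg_smult ..
  qed (use W in auto)
  \<comment> \<open>Associativity, \<open>J (H J) = (J H) J\<close>, makes \<open>J\<close>
    intertwine the pair (\<open>H J\<close>, \<open>C J\<close>) with (\<open>J H\<close>,
    \<open>C\<close>).\<close>
  also have "\<dots> = {w \<in> carrier_vec n. J *\<^sub>v w \<in> unobservable_subspace (J * H) C}"
    using assoc_mult_mat[OF J(1) H(1) J(1)]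
    by (intro unobservable_subspace_intertwining[OF HJ CJ JH C J(1)]) auto
  finally show "unobservable_subspace (mat_adjoint A) (mat_adjoint B)
      = {w \<in> carrier_vec n. J *\<^sub>v w \<in> unobservable_subspace A C}"
    unfolding * .
qed

section \<open>The symplectic structure\<close>

text \<open>Each row of the left factor has a single nonzero entry and so picks one row of
  \<open>M\<close>. This form covers \<open>JJ\<close>, \<open>JJ_bar\<close> and the coordinate
  selection of condition (ii).\<close>

lemma index_signed_selection_mult:
  fixes s :: "nat \<Rightarrow> 'a :: semiring_1"
  assumes "M \<in> carrier_mat n c" "i < r" "f i < n" "j < c"
  shows "(mat r n (\<lambda>(i, j). if j = f i then s i else 0) * M) $$ (i, j) = s i * M $$ (f i, j)"
  using assms
  by (simp add: scalar_prod_def atLeast0LessThan if_distrib[of "\<lambda>x. x * _"] cong: if_cong)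

lemma index_signed_selection_mult_vec:
  fixes s :: "nat \<Rightarrow> 'a :: semiring_1"
  assumes "w \<in> carrier_vec n" "i < r" "f i < n"
  shows "(mat r n (\<lambda>(i, j). if j = f i then s i else 0) *\<^sub>v w) $ i = s i * w $ f i"
  using assms
  by (simp add: scalar_prod_def atLeast0LessThan if_distrib[of "\<lambda>x. x * _"] cong: if_cong)

text \<open>The Kronecker product of a 2 by 2 matrix with the identity. \<open>V_mat\<close>,
  \<open>J_mat\<close> and \<open>JJ\<close> all have this shape, so identities between them reduce
  to 2 by 2 arithmetic.\<close>

definition scalar_blocks :: "nat \<Rightarrow> complex \<Rightarrow> complex \<Rightarrow> complex \<Rightarrow> complex \<Rightarrow> complex mat" where
  "scalar_blocks k a b c d =
     four_block_mat (a \<cdot>\<^sub>m 1\<^sub>m k) (b \<cdot>\<^sub>m 1\<^sub>m k) (c \<cdot>\<^sub>m 1\<^sub>m k) (d \<cdot>\<^sub>m 1\<^sub>m k)"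

lemma scalar_blocks_carrier [simp]: "scalar_blocks k a b c d \<in> carrier_mat (2 * k) (2 * k)"
  by (simp add: scalar_blocks_def mult_2)

lemma scalar_blocks_mult:
  "scalar_blocks k a b c d * scalar_blocks k a' b' c' d' =
     scalar_blocks k (a * a' + b * c') (a * b' + b * d') (c * a' + d * c') (c * b' + d * d')"
proof -
  have mult: "(x \<cdot>\<^sub>m 1\<^sub>m k) * (y \<cdot>\<^sub>m 1\<^sub>m k) = (x * y) \<cdot>\<^sub>m 1\<^sub>m k" for x y :: complex
    by (subst mult_smult_assoc_mat[of _ k k _ k]) (auto intro!: eq_matI)
  have add: "x \<cdot>\<^sub>m 1\<^sub>m k + y \<cdot>\<^sub>m 1\<^sub>m k = (x + y) \<cdot>\<^sub>m 1\<^sub>m k" for x y :: complex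
    by (intro eq_matI) (auto simp: distrib_right)
  show ?thesis
    unfolding scalar_blocks_def
    by (subst mult_four_block_mat[of _ k k _ k _ k _ _ k _ k]) (auto simp: mult add)
qed

lemma scalar_blocks_adjoint:
  "mat_adjoint (scalar_blocks k a b c d) = scalar_blocks k (cnj a) (cnj c) (cnj b) (cnj d)"
  by (intro eq_matI) (auto simp: scalar_blocks_def)

lemma scalar_blocks_smult:
  "x \<cdot>\<^sub>m scalar_blocks k a b c d = scalar_blocks k (x * a) (x * b) (x * c) (x * d)"
  by (intro eq_matI) (auto simp: scalar_blocks_def)

lemma one_scalar_blocks: "1\<^sub>m (2 * k) = scalar_blocks k 1 0 0 1"
  by (intro eq_matI) (auto simp: scalar_blocks_def)

lemma J_mat_scalar_blocks: "J_mat k = scalar_blocks k 1 0 0 (- 1)"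
  by (intro eq_matI) (auto simp: scalar_blocks_def J_mat_def)

lemma JJ_scalar_blocks: "JJ k = scalar_blocks k 0 1 (- 1) 0"
  by (intro eq_matI) (auto simp: scalar_blocks_def JJ_def)

lemma V_mat_scalar_blocks:
  "V_mat k = scalar_blocks k (1 / sqrt 2) (1 / sqrt 2) (- \<i> / sqrt 2) (\<i> / sqrt 2)"
  by (intro eq_matI) (auto simp: scalar_blocks_def V_mat_def)

lemma inverse_sqrt2_squared: "1 / complex_of_real (sqrt 2) * (1 / complex_of_real (sqrt 2)) = 1 / 2"
  by (simp flip: of_real_mult)

lemma V_mat_carrier [simp]: "V_mat k \<in> carrier_mat (2 * k) (2 * k)"
  by (simp add: V_mat_scalar_blocks)

lemma JJ_carrier [simp]: "JJ k \<in> carrier_mat (2 * k) (2 * k)"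
  by (simp add: JJ_scalar_blocks)

lemma J_mat_carrier [simp]: "J_mat k \<in> carrier_mat (2 * k) (2 * k)"
  by (simp add: J_mat_scalar_blocks)

lemma V_mat_unitary: "mat_adjoint (V_mat k) * V_mat k = 1\<^sub>m (2 * k)"
  using inverse_sqrt2_squared
  by (simp add: V_mat_scalar_blocks scalar_blocks_adjoint scalar_blocks_mult one_scalar_blocks)

text \<open>The passage to field quadratures carries the signature \<open>J_mat\<close> to the
  symplectic form. Half of the factor -\<i> is the coefficient of the coupling term in
  \<open>qsde_A\<close>.\<close>

lemma V_mat_conjugates_JJ:
  "mat_adjoint (V_mat k) * JJ k * V_mat k = (- \<i>) \<cdot>\<^sub>m J_mat k"
  using inverse_sqrt2_squared
  by (simp add: V_mat_scalar_blocks JJ_scalar_blocks J_mat_scalar_blocks scalar_blocks_adjoint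
      scalar_blocks_mult scalar_blocks_smult del: assoc_mult_mat)

lemma JJ_unitary: "JJ k * mat_adjoint (JJ k) = 1\<^sub>m (2 * k)"
  by (simp add: JJ_scalar_blocks scalar_blocks_adjoint scalar_blocks_mult one_scalar_blocks)

lemma index_JJ:
  "i < 2 * k \<Longrightarrow> j < 2 * k \<Longrightarrow>
    JJ k $$ (i, j) = (if j = i + k then 1 else if i = j + k then - 1 else 0)"
  by (auto simp: JJ_def)

lemma index_JJ_mult:
  assumes "M \<in> carrier_mat (2 * k) c" "i < 2 * k" "j < c"
  shows "(JJ k * M) $$ (i, j) = (if i < k then M $$ (i + k, j) else - M $$ (i - k, j))"
proof -
  have "JJ k = mat (2 * k) (2 * k) (\<lambda>(i, j). if j = (if i < k then i + k else i - k)
      then (if i < k then 1 else - 1) else 0)"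
    by (intro eq_matI) (auto simp: JJ_def)
  then show ?thesis
    using index_signed_selection_mult[where f = "\<lambda>i. if i < k then i + k else i - k"
        and s = "\<lambda>i. if i < k then 1 else - 1", OF assms(1,2) _ assms(3)] assms(2)
    by (simp del: index_mult_mat split: if_splits)
qed

text \<open>With labels for the four groups of variables, a zero pattern is a relation between row
  and column labels and can be proved entry by entry.\<close>

datatype block = QH | PH | CO | CC

section \<open>Coordinates, blocks and canonical conjugation\<close>

locale block_dimensions =
  fixes n1 n2 n3 :: nat
begin

abbreviation (input) "N \<equiv> 2 * (n1 + n2 + n3)"

text \<open>\<open>CC\<close> is also the default beyond \<open>N\<close>, which is why its clause
  in \<open>block_bounds\<close> asks for i < \<open>N\<close>.\<close>

definition block :: "nat \<Rightarrow> block" where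
  "block i = (if i < n3 then QH else if i < 2 * n3 then PH else if i < 2 * n3 + 2 * n1 then CO else CC)"

text \<open>\<open>JJ_bar\<close> is a signed permutation matrix: its row \<open>i\<close> has the single nonzero entry
  \<open>conj_sign i\<close> in column \<open>conj_index i\<close>, the index of the variable canonically conjugate to
  the \<open>i\<close>-th one.\<close>

definition conj_index :: "nat \<Rightarrow> nat" where
  "conj_index i =
    (if i < n3 then i + n3 else if i < 2 * n3 then i - n3
     else if i < 2 * n3 + n1 then i + n1 else if i < 2 * n3 + 2 * n1 then i - n1
     else if i < 2 * n3 + 2 * n1 + n2 then i + n2 else i - n2)"

definition conj_sign :: "nat \<Rightarrow> complex" where
  "conj_sign i =
    (if i < n3 \<or> 2 * n3 \<le> i \<and> i < 2 * n3 + n1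
      \<or> 2 * n3 + 2 * n1 \<le> i \<and> i < 2 * n3 + 2 * n1 + n2 then 1 else - 1)"

lemma conj_index_less: "i < N \<Longrightarrow> conj_index i < N"
  by (auto simp: conj_index_def)

lemma conj_index_conj_index: "i < N \<Longrightarrow> conj_index (conj_index i) = i"
  by (auto simp: conj_index_def)

lemma conj_sign_conj_index: "i < N \<Longrightarrow> conj_sign (conj_index i) = - conj_sign i"
  by (auto simp: conj_index_def conj_sign_def)

lemma conj_sign_simps [simp]: "conj_sign i * conj_sign i = 1" "cnj (conj_sign i) = conj_sign i"
  "conj_sign i \<noteq> 0"
  by (simp_all add: conj_sign_def)

lemma block_conj_index:
  "i < N \<Longrightarrow> block (conj_index i) = (case block i of QH \<Rightarrow> PH | PH \<Rightarrow> QH | CO \<Rightarrow> CO | CC \<Rightarrow> CC)"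
  by (auto simp: conj_index_def block_def)

lemma JJ_bar_signed_permutation:
  "JJ_bar n1 n2 n3 = mat N N (\<lambda>(i, j). if j = conj_index i then conj_sign i else 0)"
proof (rule eq_matI)
  fix i j assume "i < dim_row (mat N N (\<lambda>(i, j). if j = conj_index i then conj_sign i else 0))"
    "j < dim_col (mat N N (\<lambda>(i, j). if j = conj_index i then conj_sign i else 0))"
  then have ij: "i < N" "j < N" by auto
  have dims: "dim_row (JJ k) = 2 * k" "dim_col (JJ k) = 2 * k" for k
    by (rule carrier_matD[OF JJ_carrier])+
  have index: "JJ_bar n1 n2 n3 $$ (i, j)
      = (if i < 2 * n3 then if j < 2 * n3 then JJ n3 $$ (i, j) else 0
         else if i < 2 * n3 + 2 * n1
         then if 2 * n3 \<le> j \<and> j < 2 * n3 + 2 * n1 then JJ n1 $$ (i - 2 * n3, j - 2 * n3) else 0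
         else if 2 * n3 + 2 * n1 \<le> j
         then JJ n2 $$ (i - 2 * n3 - 2 * n1, j - 2 * n3 - 2 * n1) else 0)"
    using ij by (simp add: JJ_bar_def Let_def dims) auto
  \<comment> \<open>The cases follow the three diagonal blocks of \<open>JJ_bar\<close>, so
    \<open>q_h\<close> and \<open>p_h\<close> fall into one case. Splitting indices into offset and
    local index then reduces each case to \<open>index_JJ\<close>.\<close>
  consider "i < 2 * n3" | "2 * n3 \<le> i" "i < 2 * n3 + 2 * n1" | "2 * n3 + 2 * n1 \<le> i"
    by linarith
  then have "JJ_bar n1 n2 n3 $$ (i, j) = (if j = conj_index i then conj_sign i else 0)"
  proof cases
    case 1
    then show ?thesis
      using ij by (auto simp: index index_JJ conj_index_def conj_sign_def)
  next
    case 2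
    then obtain i' where i: "i = 2 * n3 + i'" "i' < 2 * n1"
      by (metis add_less_cancel_left le_Suc_ex)
    show ?thesis
    proof (cases "2 * n3 \<le> j \<and> j < 2 * n3 + 2 * n1")
      case True
      then obtain j' where "j = 2 * n3 + j'" "j' < 2 * n1"
        by (metis add_less_cancel_left le_Suc_ex)
      then show ?thesis
        unfolding index using i by (simp add: index_JJ conj_index_def conj_sign_def) arith
    next
      case False
      then show ?thesis
        unfolding index using i by (simp add: conj_index_def) arith
    qed
  next
    case 3
    then obtain i' where i: "i = 2 * n3 + 2 * n1 + i'" "i' < 2 * n2"
      using ij by (metis add_less_cancel_left le_Suc_ex distrib_left add.assoc add.commute)
    show ?thesis
    proof (cases "2 * n3 + 2 * n1 \<le> j")
      case True
      then obtain j' where "j = 2 * n3 + 2 * n1 + j'" "j' < 2 * n2"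
        using ij by (metis add_less_cancel_left le_Suc_ex distrib_left add.assoc add.commute)
      then show ?thesis
        unfolding index using i by (simp add: index_JJ conj_index_def conj_sign_def) arith
    next
      case False
      then show ?thesis
        unfolding index using i by (simp add: conj_index_def) arith
    qed
  qed
  then show "JJ_bar n1 n2 n3 $$ (i, j)
      = mat N N (\<lambda>(i, j). if j = conj_index i then conj_sign i else 0) $$ (i, j)"
    using ij by simp
qed (auto simp: JJ_bar_def dim_diag_block_mat JJ_def)

lemma JJ_bar_carrier [simp]: "JJ_bar n1 n2 n3 \<in> carrier_mat N N"
  by (simp add: JJ_bar_signed_permutation)

text \<open>All entries are real, and conjugate positions carry opposite signs.\<close>

lemma JJ_bar_adjoint: "mat_adjoint (JJ_bar n1 n2 n3) = - JJ_bar n1 n2 n3"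
proof (rule eq_matI)
  fix i j assume "i < dim_row (- JJ_bar n1 n2 n3)" "j < dim_col (- JJ_bar n1 n2 n3)"
  then have ij: "i < N" "j < N"
    using JJ_bar_carrier by auto
  have "i = conj_index j \<longleftrightarrow> j = conj_index i"
    using ij conj_index_conj_index by metis
  then show "mat_adjoint (JJ_bar n1 n2 n3) $$ (i, j) = (- JJ_bar n1 n2 n3) $$ (i, j)"
    using ij conj_sign_conj_index by (auto simp: JJ_bar_signed_permutation)
qed (use JJ_bar_carrier in auto)

lemma index_JJ_bar_mult:
  assumes "M \<in> carrier_mat N c" "i < N" "j < c"
  shows "(JJ_bar n1 n2 n3 * M) $$ (i, j) = conj_sign i * M $$ (conj_index i, j)"
  unfolding JJ_bar_signed_permutation
  by (rule index_signed_selection_mult[where f = conj_index, OF assms(1,2) conj_index_less[OF assms(2)] assms(3)])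

lemma index_JJ_bar_mult_vec:
  assumes "w \<in> carrier_vec N" "i < N"
  shows "(JJ_bar n1 n2 n3 *\<^sub>v w) $ i = conj_sign i * w $ conj_index i"
  unfolding JJ_bar_signed_permutation
  by (rule index_signed_selection_mult_vec[where f = conj_index, OF assms conj_index_less[OF assms(2)]])

lemma index_append_rows_blocks:
  assumes "A \<in> carrier_mat n3 c" "B \<in> carrier_mat n3 c" "C \<in> carrier_mat (2 * n1) c"
    "D \<in> carrier_mat (2 * n2) c" "i < N" "j < c"
  shows "(A @\<^sub>r B @\<^sub>r C @\<^sub>r D) $$ (i, j) = (case block i of QH \<Rightarrow> A $$ (i, j)
    | PH \<Rightarrow> B $$ (i - n3, j) | CO \<Rightarrow> C $$ (i - 2 * n3, j) | CC \<Rightarrow> D $$ (i - 2 * n3 - 2 * n1, j))"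
  using assms by (auto simp: index_append_rows block_def mult_2 diff_diff_left)

lemma index_append_cols_blocks:
  assumes "A \<in> carrier_mat r n3" "B \<in> carrier_mat r n3" "C \<in> carrier_mat r (2 * n1)"
    "D \<in> carrier_mat r (2 * n2)" "i < r" "j < N"
  shows "(A @\<^sub>c B @\<^sub>c C @\<^sub>c D) $$ (i, j) = (case block j of QH \<Rightarrow> A $$ (i, j)
    | PH \<Rightarrow> B $$ (i, j - n3) | CO \<Rightarrow> C $$ (i, j - 2 * n3) | CC \<Rightarrow> D $$ (i, j - 2 * n3 - 2 * n1))"
  using assms by (auto simp: index_append_cols block_def mult_2 diff_diff_left)

lemma append_rows_blocks_carrier:
  assumes "A \<in> carrier_mat n3 c" "B \<in> carrier_mat n3 c" "C \<in> carrier_mat (2 * n1) c"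
    "D \<in> carrier_mat (2 * n2) c"
  shows "A @\<^sub>r B @\<^sub>r C @\<^sub>r D \<in> carrier_mat N c"
  using assms by (intro carrier_matI) auto

lemma append_cols_blocks_carrier:
  assumes "A \<in> carrier_mat r n3" "B \<in> carrier_mat r n3" "C \<in> carrier_mat r (2 * n1)"
    "D \<in> carrier_mat r (2 * n2)"
  shows "A @\<^sub>c B @\<^sub>c C @\<^sub>c D \<in> carrier_mat r N"
  using assms by (intro carrier_matI) auto

end

section \<open>Block patterns\<close>

text \<open>Gives explicit witnesses for the blocks that the canonical form and the converse of the
  theorem quantify existentially.\<close>

definition subblock :: "'a mat \<Rightarrow> nat \<Rightarrow> nat \<Rightarrow> nat \<Rightarrow> nat \<Rightarrow> 'a mat" where
  "subblock X i j r c = mat r c (\<lambda>(k, l). X $$ (i + k, j + l))"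

lemma subblock_carrier [simp]: "subblock X i j r c \<in> carrier_mat r c"
  by (simp add: subblock_def)

lemma dim_subblock [simp]: "dim_row (subblock X i j r c) = r" "dim_col (subblock X i j r c) = c"
  by (simp_all add: subblock_def)

lemma index_subblock [simp]: "k < r \<Longrightarrow> l < c \<Longrightarrow> subblock X i j r c $$ (k, l) = X $$ (i + k, j + l)"
  by (simp add: subblock_def)

context block_dimensions
begin

definition kalman_drift :: "'a :: zero mat \<Rightarrow> bool" where
  "kalman_drift A \<longleftrightarrow> (\<forall>i<N. \<forall>j<N. A $$ (i, j) \<noteq> 0 \<longrightarrow>
     block i = QH \<or> block j = PH \<or> block i = block j)"

definition kalman_input :: "'a :: zero mat \<Rightarrow> bool" where
  "kalman_input B \<longleftrightarrow> (\<forall>i<N. \<forall>j<dim_col B. B $$ (i, j) \<noteq> 0 \<longrightarrow> block i = QH \<or> block i = CO)"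

definition kalman_output :: "'a :: zero mat \<Rightarrow> bool" where
  "kalman_output C \<longleftrightarrow> (\<forall>i<dim_row C. \<forall>j<N. C $$ (i, j) \<noteq> 0 \<longrightarrow> block j = PH \<or> block j = CO)"

text \<open>The pattern \<open>kalman_drift\<close> with the row label replaced by its conjugate.
  Excluding \<open>QH\<close> on the diagonal corresponds to the zero of the drift in the
  \<open>p_h\<close> rows and \<open>q_h\<close> columns.\<close>

definition kalman_hamiltonian :: "'a :: zero mat \<Rightarrow> bool" where
  "kalman_hamiltonian H \<longleftrightarrow> (\<forall>i<N. \<forall>j<N. H $$ (i, j) \<noteq> 0 \<longrightarrow>
     block i = PH \<or> block j = PH \<or> block i = block j \<and> block i \<noteq> QH)"

lemma block_bounds:
  "block i = QH \<Longrightarrow> i < n3"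
  "block i = PH \<Longrightarrow> n3 \<le> i \<and> i - n3 < n3"
  "block i = CO \<Longrightarrow> 2 * n3 \<le> i \<and> i - 2 * n3 < 2 * n1"
  "block i = CC \<Longrightarrow> i < N \<Longrightarrow> 2 * n3 + 2 * n1 \<le> i \<and> i - 2 * n3 - 2 * n1 < 2 * n2"
  by (auto simp: block_def split: if_splits)

lemma index_block_matrix:
  assumes "A1 \<in> carrier_mat n3 n3" "A2 \<in> carrier_mat n3 n3" "A3 \<in> carrier_mat n3 (2 * n1)" "A4 \<in> carrier_mat n3 (2 * n2)"
    and "B1 \<in> carrier_mat n3 n3" "B2 \<in> carrier_mat n3 n3" "B3 \<in> carrier_mat n3 (2 * n1)" "B4 \<in> carrier_mat n3 (2 * n2)"
    and "C1 \<in> carrier_mat (2 * n1) n3" "C2 \<in> carrier_mat (2 * n1) n3" "C3 \<in> carrier_mat (2 * n1) (2 * n1)" "C4 \<in> carrier_mat (2 * n1) (2 * n2)"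
    and "D1 \<in> carrier_mat (2 * n2) n3" "D2 \<in> carrier_mat (2 * n2) n3" "D3 \<in> carrier_mat (2 * n2) (2 * n1)" "D4 \<in> carrier_mat (2 * n2) (2 * n2)"
    and "i < N" "j < N"
  shows "(A1 @\<^sub>c A2 @\<^sub>c A3 @\<^sub>c A4 @\<^sub>r B1 @\<^sub>c B2 @\<^sub>c B3 @\<^sub>c B4 @\<^sub>r C1 @\<^sub>c C2 @\<^sub>c C3 @\<^sub>c C4 @\<^sub>r D1 @\<^sub>c D2 @\<^sub>c D3 @\<^sub>c D4) $$ (i, j) =
    (case block i of
       QH \<Rightarrow> (case block j of QH \<Rightarrow> A1 $$ (i, j) | PH \<Rightarrow> A2 $$ (i, j - n3)
         | CO \<Rightarrow> A3 $$ (i, j - 2 * n3) | CC \<Rightarrow> A4 $$ (i, j - 2 * n3 - 2 * n1))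
     | PH \<Rightarrow> (case block j of QH \<Rightarrow> B1 $$ (i - n3, j) | PH \<Rightarrow> B2 $$ (i - n3, j - n3)
         | CO \<Rightarrow> B3 $$ (i - n3, j - 2 * n3) | CC \<Rightarrow> B4 $$ (i - n3, j - 2 * n3 - 2 * n1))
     | CO \<Rightarrow> (case block j of QH \<Rightarrow> C1 $$ (i - 2 * n3, j) | PH \<Rightarrow> C2 $$ (i - 2 * n3, j - n3)
         | CO \<Rightarrow> C3 $$ (i - 2 * n3, j - 2 * n3) | CC \<Rightarrow> C4 $$ (i - 2 * n3, j - 2 * n3 - 2 * n1))
     | CC \<Rightarrow> (case block j of QH \<Rightarrow> D1 $$ (i - 2 * n3 - 2 * n1, j)
         | PH \<Rightarrow> D2 $$ (i - 2 * n3 - 2 * n1, j - n3)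
         | CO \<Rightarrow> D3 $$ (i - 2 * n3 - 2 * n1, j - 2 * n3)
         | CC \<Rightarrow> D4 $$ (i - 2 * n3 - 2 * n1, j - 2 * n3 - 2 * n1)))"
  using block_bounds[of i] assms(17)
  by (subst index_append_rows_blocks[OF append_cols_blocks_carrier append_cols_blocks_carrier
        append_cols_blocks_carrier append_cols_blocks_carrier, OF assms])
    (auto split: block.split simp: index_append_cols_blocks[OF assms(1-4) _ assms(18)]
      index_append_cols_blocks[OF assms(5-8) _ assms(18)] index_append_cols_blocks[OF assms(9-12) _ assms(18)]
      index_append_cols_blocks[OF assms(13-16) _ assms(18)])

section \<open>Block matrices and their zero patterns\<close>

lemma kalman_drift_blocks:
  assumes A: "A \<in> carrier_mat N N" and pattern: "kalman_drift A"
  shows "A = subblock A 0 0 n3 n3 @\<^sub>c subblock A 0 n3 n3 n3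
           @\<^sub>c subblock A 0 (2 * n3) n3 (2 * n1) @\<^sub>c subblock A 0 (2 * n3 + 2 * n1) n3 (2 * n2)
      @\<^sub>r 0\<^sub>m n3 n3 @\<^sub>c subblock A n3 n3 n3 n3 @\<^sub>c 0\<^sub>m n3 (2 * n1) @\<^sub>c 0\<^sub>m n3 (2 * n2)
      @\<^sub>r 0\<^sub>m (2 * n1) n3 @\<^sub>c subblock A (2 * n3) n3 (2 * n1) n3
           @\<^sub>c subblock A (2 * n3) (2 * n3) (2 * n1) (2 * n1) @\<^sub>c 0\<^sub>m (2 * n1) (2 * n2)
      @\<^sub>r 0\<^sub>m (2 * n2) n3 @\<^sub>c subblock A (2 * n3 + 2 * n1) n3 (2 * n2) n3 @\<^sub>c 0\<^sub>m (2 * n2) (2 * n1)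
           @\<^sub>c subblock A (2 * n3 + 2 * n1) (2 * n3 + 2 * n1) (2 * n2) (2 * n2)"
    (is "_ = ?R")
proof -
  have R: "?R \<in> carrier_mat N N"
    by (intro append_rows_blocks_carrier append_cols_blocks_carrier) auto
  show "A = ?R"
  proof (rule eq_matI)
    fix i j assume "i < dim_row ?R" "j < dim_col ?R"
    then have ij: "i < N" "j < N"
      using R by auto
    have "A $$ (i, j) = 0" if "block i \<noteq> QH" "block j \<noteq> PH" "block i \<noteq> block j"
      using pattern ij that by (auto simp: kalman_drift_def)
    then show "A $$ (i, j) = ?R $$ (i, j)"
      using ij block_bounds[of i] block_bounds[of j]
      by (subst index_block_matrix) (auto split: block.split)
  qed (use A R in auto)
qed

lemma kalman_input_blocks:
  assumes B: "B \<in> carrier_mat N c" and pattern: "kalman_input B"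
  shows "B = subblock B 0 0 n3 c @\<^sub>r 0\<^sub>m n3 c
    @\<^sub>r subblock B (2 * n3) 0 (2 * n1) c @\<^sub>r 0\<^sub>m (2 * n2) c"
    (is "_ = ?R")
proof -
  have R: "?R \<in> carrier_mat N c"
    by (intro append_rows_blocks_carrier) auto
  show "B = ?R"
  proof (rule eq_matI)
    fix i j assume "i < dim_row ?R" "j < dim_col ?R"
    then have ij: "i < N" "j < c"
      using R by auto
    have "B $$ (i, j) = 0" if "block i \<noteq> QH" "block i \<noteq> CO"
      using pattern ij that B by (auto simp: kalman_input_def)
    then show "B $$ (i, j) = ?R $$ (i, j)"
      using ij block_bounds[of i]
      by (subst index_append_rows_blocks) (auto split: block.split)
  qed (use B R in auto)
qed

lemma kalman_output_blocks:
  assumes C: "C \<in> carrier_mat r N" and pattern: "kalman_output C"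
  shows "C = 0\<^sub>m r n3 @\<^sub>c subblock C 0 n3 r n3
    @\<^sub>c subblock C 0 (2 * n3) r (2 * n1) @\<^sub>c 0\<^sub>m r (2 * n2)"
    (is "_ = ?R")
proof -
  have R: "?R \<in> carrier_mat r N"
    by (intro append_cols_blocks_carrier) auto
  show "C = ?R"
  proof (rule eq_matI)
    fix i j assume "i < dim_row ?R" "j < dim_col ?R"
    then have ij: "i < r" "j < N"
      using R by auto
    have "C $$ (i, j) = 0" if "block j \<noteq> PH" "block j \<noteq> CO"
      using pattern ij that C by (auto simp: kalman_output_def)
    then show "C $$ (i, j) = ?R $$ (i, j)"
      using ij block_bounds[of j]
      by (subst index_append_cols_blocks) (auto split: block.split)
  qed (use C R in auto)
qed

lemma subblock_append_cols_blocks: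
  assumes "A1 \<in> carrier_mat r n3" "A2 \<in> carrier_mat r n3" "A3 \<in> carrier_mat r (2 * n1)"
    "A4 \<in> carrier_mat r (2 * n2)"
  defines "X \<equiv> A1 @\<^sub>c A2 @\<^sub>c A3 @\<^sub>c A4"
  shows "subblock X 0 n3 r n3 = A2" "subblock X 0 (2 * n3) r (2 * n1) = A3"
  using assms(1-4)
  by (auto simp: X_def index_append_cols_blocks[OF assms(1-4)] block_def intro!: eq_matI)

text \<open>A matrix with the right zeros is the block matrix of its own subblocks, so the
  existential statement about blocks becomes a condition on entries.\<close>

lemma kalman_canonical_form_iff:
  assumes A: "A \<in> carrier_mat N N" and B: "B \<in> carrier_mat N (2 * m)" and C: "C \<in> carrier_mat (2 * m) N"
  shows "kalman_canonical_form n1 n2 n3 m A B C \<longleftrightarrow>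
    kalman_drift A \<and> kalman_input B \<and> kalman_output C \<and>
    controllable_subspace A B = coord_subspace N (idx_qh n3 \<union> idx_co n1 n3) \<and>
    unobservable_subspace A C = coord_subspace N (idx_qh n3 \<union> idx_cc n1 n2 n3)"
    (is "?L \<longleftrightarrow> ?R")
proof
  assume ?R
  then show ?L
    unfolding kalman_canonical_form_def
    using kalman_drift_blocks[OF A] kalman_input_blocks[OF B] kalman_output_blocks[OF C]
    by (metis subblock_carrier)
next
  assume ?L
  then obtain Ah11 Ah12 A12 A13 Ah22 A21 Aco A31 Acc Bh Bco Ch Cco where
    carriers: "Ah11 \<in> carrier_mat n3 n3" "Ah12 \<in> carrier_mat n3 n3"
      "A12 \<in> carrier_mat n3 (2 * n1)" "A13 \<in> carrier_mat n3 (2 * n2)"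
      "Ah22 \<in> carrier_mat n3 n3"
      "A21 \<in> carrier_mat (2 * n1) n3" "Aco \<in> carrier_mat (2 * n1) (2 * n1)"
      "A31 \<in> carrier_mat (2 * n2) n3" "Acc \<in> carrier_mat (2 * n2) (2 * n2)"
      "Bh \<in> carrier_mat n3 (2 * m)" "Bco \<in> carrier_mat (2 * n1) (2 * m)"
      "Ch \<in> carrier_mat (2 * m) n3" "Cco \<in> carrier_mat (2 * m) (2 * n1)"
    and A_eq: "A = Ah11 @\<^sub>c Ah12 @\<^sub>c A12 @\<^sub>c A13
         @\<^sub>r 0\<^sub>m n3 n3           @\<^sub>c Ah22 @\<^sub>c 0\<^sub>m n3 (2 * n1)         @\<^sub>c 0\<^sub>m n3 (2 * n2)
         @\<^sub>r 0\<^sub>m (2 * n1) n3     @\<^sub>c A21  @\<^sub>c Aco                      @\<^sub>c 0\<^sub>m (2 * n1) (2 * n2)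
         @\<^sub>r 0\<^sub>m (2 * n2) n3     @\<^sub>c A31  @\<^sub>c 0\<^sub>m (2 * n2) (2 * n1)   @\<^sub>c Acc"
    and B_eq: "B = Bh @\<^sub>r 0\<^sub>m n3 (2 * m) @\<^sub>r Bco @\<^sub>r 0\<^sub>m (2 * n2) (2 * m)"
    and C_eq: "C = 0\<^sub>m (2 * m) n3 @\<^sub>c Ch @\<^sub>c Cco @\<^sub>c 0\<^sub>m (2 * m) (2 * n2)"
    and subspaces: "controllable_subspace A B = coord_subspace N (idx_qh n3 \<union> idx_co n1 n3)"
      "unobservable_subspace A C = coord_subspace N (idx_qh n3 \<union> idx_cc n1 n2 n3)"
    unfolding kalman_canonical_form_def by blast
  have "A $$ (i, j) = 0" if "i < N" "j < N" "block i \<noteq> QH" "block j \<noteq> PH" "block i \<noteq> block j" for i j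
    unfolding A_eq using carriers that block_bounds[of i] block_bounds[of j]
    by (subst index_block_matrix) (auto split: block.split)
  then have "kalman_drift A"
    unfolding kalman_drift_def by blast
  moreover have "B $$ (i, j) = 0" if "i < N" "j < 2 * m" "block i \<noteq> QH" "block i \<noteq> CO" for i j
    unfolding B_eq using carriers that block_bounds[of i]
    by (subst index_append_rows_blocks) (auto split: block.split)
  then have "kalman_input B"
    unfolding kalman_input_def using B by auto
  moreover have "C $$ (i, j) = 0" if "i < 2 * m" "j < N" "block j \<noteq> PH" "block j \<noteq> CO" for i j
    unfolding C_eq using carriers that block_bounds[of j]
    by (subst index_append_cols_blocks) (auto split: block.split)
  then have "kalman_output C"
    unfolding kalman_output_def using C by auto
  ultimately show ?R
    using subspaces by simp
qed


text \<open>The block form determines its blocks, hence condition (ii) depends on \<open>H\<close>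
  and \<open>\<Gamma>\<close> only. Off-diagonal blocks come in transposed pairs, and (i) handles
  the diagonal, which together make \<open>H\<close> symmetric.\<close>

lemma hamiltonian_coupling_block_formD:
  assumes form: "hamiltonian_coupling_block_form n1 n2 n3 m H \<Gamma> Hh12 Hh22 H12 H13 Hco Hcc \<Gamma>h \<Gamma>co"
    and sym: "Hh22 = Hh22\<^sup>T" "Hco = Hco\<^sup>T" "Hcc = Hcc\<^sup>T"
  shows "H\<^sup>T = H" "kalman_hamiltonian H" "kalman_output (doubled \<Gamma>)"
    and "Hh12 = subblock H 0 n3 n3 n3" "H12 = subblock H n3 (2 * n3) n3 (2 * n1)"
    and "Hco = subblock H (2 * n3) (2 * n3) (2 * n1) (2 * n1)"
    and "\<Gamma>h = subblock (doubled \<Gamma>) 0 n3 (2 * m) n3"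
    and "\<Gamma>co = subblock (doubled \<Gamma>) 0 (2 * n3) (2 * m) (2 * n1)"
proof -
  have carriers: "Hh12 \<in> carrier_mat n3 n3" "Hh22 \<in> carrier_mat n3 n3"
     "H12 \<in> carrier_mat n3 (2 * n1)" "H13 \<in> carrier_mat n3 (2 * n2)"
     "Hco \<in> carrier_mat (2 * n1) (2 * n1)" "Hcc \<in> carrier_mat (2 * n2) (2 * n2)"
     "\<Gamma>h \<in> carrier_mat (2 * m) n3" "\<Gamma>co \<in> carrier_mat (2 * m) (2 * n1)"
    and H_eq: "H = 0\<^sub>m n3 n3         @\<^sub>c Hh12  @\<^sub>c 0\<^sub>m n3 (2 * n1)         @\<^sub>c 0\<^sub>m n3 (2 * n2)
      @\<^sub>r Hh12\<^sup>T            @\<^sub>c Hh22  @\<^sub>c H12                      @\<^sub>c H13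
      @\<^sub>r 0\<^sub>m (2 * n1) n3   @\<^sub>c H12\<^sup>T  @\<^sub>c Hco                      @\<^sub>c 0\<^sub>m (2 * n1) (2 * n2)
      @\<^sub>r 0\<^sub>m (2 * n2) n3   @\<^sub>c H13\<^sup>T  @\<^sub>c 0\<^sub>m (2 * n2) (2 * n1)   @\<^sub>c Hcc" (is "_ = ?H")
    and \<Gamma>_eq: "doubled \<Gamma> = 0\<^sub>m (2 * m) n3 @\<^sub>c \<Gamma>h @\<^sub>c \<Gamma>co @\<^sub>c 0\<^sub>m (2 * m) (2 * n2)"
    using form unfolding hamiltonian_coupling_block_form_def by auto
  have H: "H \<in> carrier_mat N N"
    unfolding H_eq using carriers by (intro append_rows_blocks_carrier append_cols_blocks_carrier) auto
  have \<Gamma>: "doubled \<Gamma> \<in> carrier_mat (2 * m) N"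
    unfolding \<Gamma>_eq using carriers by (intro append_cols_blocks_carrier) auto
  have sym': "Hh22 $$ (a, b) = Hh22 $$ (b, a)" if "a < n3" "b < n3" for a b
    using carriers that by (subst sym(1)) simp
  have sym'': "Hco $$ (a, b) = Hco $$ (b, a)" if "a < 2 * n1" "b < 2 * n1" for a b
    using carriers that by (subst sym(2)) simp
  have sym''': "Hcc $$ (a, b) = Hcc $$ (b, a)" if "a < 2 * n2" "b < 2 * n2" for a b
    using carriers that by (subst sym(3)) simp
  have index: "H $$ (i, j) = (case block i of
       QH \<Rightarrow> if block j = PH then Hh12 $$ (i, j - n3) else 0
     | PH \<Rightarrow> (case block j of QH \<Rightarrow> Hh12 $$ (j, i - n3) | PH \<Rightarrow> Hh22 $$ (i - n3, j - n3)
         | CO \<Rightarrow> H12 $$ (i - n3, j - 2 * n3) | CC \<Rightarrow> H13 $$ (i - n3, j - 2 * n3 - 2 * n1))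
     | CO \<Rightarrow> (case block j of QH \<Rightarrow> 0 | PH \<Rightarrow> H12 $$ (j - n3, i - 2 * n3)
         | CO \<Rightarrow> Hco $$ (i - 2 * n3, j - 2 * n3) | CC \<Rightarrow> 0)
     | CC \<Rightarrow> (case block j of QH \<Rightarrow> 0 | PH \<Rightarrow> H13 $$ (j - n3, i - 2 * n3 - 2 * n1)
         | CO \<Rightarrow> 0 | CC \<Rightarrow> Hcc $$ (i - 2 * n3 - 2 * n1, j - 2 * n3 - 2 * n1)))"
    if "i < N" "j < N" for i j
    unfolding H_eq using carriers that block_bounds[of i] block_bounds[of j]
    by (subst index_block_matrix) (auto split: block.split)
  show "H\<^sup>T = H"
  proof (rule eq_matI)
    fix i j assume "i < dim_row H" "j < dim_col H"
    then have ij: "i < N" "j < N"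
      using H by auto
    have "H $$ (j, i) = H $$ (i, j)"
      unfolding index[OF ij] index[OF ij(2,1)]
      using ij block_bounds[of i] block_bounds[of j]
      by (auto split: block.split intro: sym' sym'' sym''')
    then show "H\<^sup>T $$ (i, j) = H $$ (i, j)"
      using H ij by auto
  qed (use H in auto)
  show "kalman_hamiltonian H"
    unfolding kalman_hamiltonian_def by (auto simp: index split: block.splits if_splits)
  have "doubled \<Gamma> $$ (i, j) = 0" if "i < 2 * m" "j < N" "block j \<noteq> PH" "block j \<noteq> CO" for i j
    unfolding \<Gamma>_eq using carriers that block_bounds[of j]
    by (subst index_append_cols_blocks) (auto split: block.split)
  then show "kalman_output (doubled \<Gamma>)"
    unfolding kalman_output_def using \<Gamma> by auto
  show "Hh12 = subblock H 0 n3 n3 n3"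
    using carriers by (intro eq_matI) (auto simp: index block_def)
  show "H12 = subblock H n3 (2 * n3) n3 (2 * n1)"
    using carriers by (intro eq_matI) (auto simp: index block_def)
  show "Hco = subblock H (2 * n3) (2 * n3) (2 * n1) (2 * n1)"
    using carriers by (intro eq_matI) (auto simp: index block_def)
  show "\<Gamma>h = subblock (doubled \<Gamma>) 0 n3 (2 * m) n3"
    and "\<Gamma>co = subblock (doubled \<Gamma>) 0 (2 * n3) (2 * m) (2 * n1)"
    unfolding \<Gamma>_eq
    using subblock_append_cols_blocks[OF zero_carrier_mat carriers(7,8) zero_carrier_mat] by simp_all
qed

lemma hamiltonian_coupling_block_formI:
  assumes H: "H \<in> carrier_mat N N" and \<Gamma>: "doubled \<Gamma> \<in> carrier_mat (2 * m) N"
    and sym: "H\<^sup>T = H" and pattern: "kalman_hamiltonian H" and out: "kalman_output (doubled \<Gamma>)"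
  defines "Hh22 \<equiv> subblock H n3 n3 n3 n3"
    and "Hco \<equiv> subblock H (2 * n3) (2 * n3) (2 * n1) (2 * n1)"
    and "Hcc \<equiv> subblock H (2 * n3 + 2 * n1) (2 * n3 + 2 * n1) (2 * n2) (2 * n2)"
  shows "hamiltonian_coupling_block_form n1 n2 n3 m H \<Gamma>
      (subblock H 0 n3 n3 n3) Hh22 (subblock H n3 (2 * n3) n3 (2 * n1))
      (subblock H n3 (2 * n3 + 2 * n1) n3 (2 * n2)) Hco Hcc
      (subblock (doubled \<Gamma>) 0 n3 (2 * m) n3) (subblock (doubled \<Gamma>) 0 (2 * n3) (2 * m) (2 * n1))"
    and "Hh22 = Hh22\<^sup>T" "Hco = Hco\<^sup>T" "Hcc = Hcc\<^sup>T"
proof -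
  \<comment> \<open>Symmetry identifies the blocks left of the diagonal with the transposes that the
    block form prescribes.\<close>
  have sym': "H $$ (i, j) = H $$ (j, i)" if "i < N" "j < N" for i j
    using H that by (subst sym[symmetric]) simp
  show "Hh22 = Hh22\<^sup>T" "Hco = Hco\<^sup>T" "Hcc = Hcc\<^sup>T"
    by (auto simp: Hh22_def Hco_def Hcc_def intro!: eq_matI sym')
  let ?R = "0\<^sub>m n3 n3 @\<^sub>c subblock H 0 n3 n3 n3 @\<^sub>c 0\<^sub>m n3 (2 * n1) @\<^sub>c 0\<^sub>m n3 (2 * n2)
      @\<^sub>r (subblock H 0 n3 n3 n3)\<^sup>T @\<^sub>c Hh22 @\<^sub>c subblock H n3 (2 * n3) n3 (2 * n1)
           @\<^sub>c subblock H n3 (2 * n3 + 2 * n1) n3 (2 * n2)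
      @\<^sub>r 0\<^sub>m (2 * n1) n3 @\<^sub>c (subblock H n3 (2 * n3) n3 (2 * n1))\<^sup>T @\<^sub>c Hco @\<^sub>c 0\<^sub>m (2 * n1) (2 * n2)
      @\<^sub>r 0\<^sub>m (2 * n2) n3 @\<^sub>c (subblock H n3 (2 * n3 + 2 * n1) n3 (2 * n2))\<^sup>T
           @\<^sub>c 0\<^sub>m (2 * n2) (2 * n1) @\<^sub>c Hcc"
  have carriers: "Hh22 \<in> carrier_mat n3 n3" "Hco \<in> carrier_mat (2 * n1) (2 * n1)"
    "Hcc \<in> carrier_mat (2 * n2) (2 * n2)"
    by (simp_all add: Hh22_def Hco_def Hcc_def)
  have R: "?R \<in> carrier_mat N N"
    using carriers by (intro append_rows_blocks_carrier append_cols_blocks_carrier) auto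
  have "H = ?R"
  proof (rule eq_matI)
    fix i j assume "i < dim_row ?R" "j < dim_col ?R"
    then have ij: "i < N" "j < N"
      using R by auto
    have "H $$ (i, j) = 0" if "block i \<noteq> PH" "block j \<noteq> PH" "block i \<noteq> block j \<or> block i = QH"
      using pattern ij that unfolding kalman_hamiltonian_def by (metis block.distinct(1))
    then show "H $$ (i, j) = ?R $$ (i, j)"
      using ij block_bounds[of i] block_bounds[of j] sym'[OF ij] carriers
      by (subst index_block_matrix) (auto simp: Hh22_def Hco_def Hcc_def split: block.split)
  qed (use H R in auto)
  then show "hamiltonian_coupling_block_form n1 n2 n3 m H \<Gamma>
      (subblock H 0 n3 n3 n3) Hh22 (subblock H n3 (2 * n3) n3 (2 * n1))
      (subblock H n3 (2 * n3 + 2 * n1) n3 (2 * n2)) Hco Hcc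
      (subblock (doubled \<Gamma>) 0 n3 (2 * m) n3) (subblock (doubled \<Gamma>) 0 (2 * n3) (2 * m) (2 * n1))"
    unfolding hamiltonian_coupling_block_form_def
    using kalman_output_blocks[OF \<Gamma> out] by (intro conjI subblock_carrier carriers)
qed

section \<open>The pair of condition (ii)\<close>

text \<open>The coordinates of \<open>x_co\<close> followed by those of \<open>p_h\<close>, as ordered in condition (ii).\<close>

definition obs_index :: "nat \<Rightarrow> nat" where
  "obs_index i = (if i < 2 * n1 then 2 * n3 + i else n3 + (i - 2 * n1))"

text \<open>Inverts \<open>obs_index\<close> on the \<open>p_h\<close> and \<open>x_co\<close>
  indices; its values elsewhere carry no meaning.\<close>

definition obs_index_inv :: "nat \<Rightarrow> nat" where
  "obs_index_inv j = (if j < 2 * n3 then j - n3 + 2 * n1 else j - 2 * n3)"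

definition obs_selection :: "complex mat" where
  "obs_selection = mat (2 * n1 + n3) N (\<lambda>(i, j). if j = obs_index i then 1 else 0)"

text \<open>The drift of condition (ii), with its blocks read off from \<open>H\<close>.\<close>

definition obs_drift :: "real mat \<Rightarrow> complex mat" where
  "obs_drift H = JJ n1 * cmat (subblock H (2 * n3) (2 * n3) (2 * n1) (2 * n1))
      @\<^sub>c JJ n1 * cmat ((subblock H n3 (2 * n3) n3 (2 * n1))\<^sup>T)
    @\<^sub>r 0\<^sub>m n3 (2 * n1) @\<^sub>c - cmat (subblock H 0 n3 n3 n3)"

definition obs_output :: "nat \<Rightarrow> complex mat \<Rightarrow> complex mat" where
  "obs_output r G = subblock G 0 (2 * n3) r (2 * n1) @\<^sub>c subblock G 0 n3 r n3"

lemma obs_index_less: "i < 2 * n1 + n3 \<Longrightarrow> obs_index i < N"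
  by (auto simp: obs_index_def)

lemma block_obs_index: "i < 2 * n1 + n3 \<Longrightarrow> block (obs_index i) = PH \<or> block (obs_index i) = CO"
  by (auto simp: obs_index_def block_def)

lemma obs_index_inv_less: "block j = PH \<or> block j = CO \<Longrightarrow> obs_index_inv j < 2 * n1 + n3"
  by (auto simp: obs_index_inv_def block_def split: if_splits)

lemma obs_index_obs_index_inv: "block j = PH \<or> block j = CO \<Longrightarrow> obs_index (obs_index_inv j) = j"
  by (auto simp: obs_index_def obs_index_inv_def block_def split: if_splits)

lemma obs_index_inv_obs_index: "i < 2 * n1 + n3 \<Longrightarrow> obs_index_inv (obs_index i) = i"
  by (auto simp: obs_index_def obs_index_inv_def)

lemma obs_selection_carrier [simp]: "obs_selection \<in> carrier_mat (2 * n1 + n3) N"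
  by (simp add: obs_selection_def)

lemma index_obs_selection_mult:
  assumes "M \<in> carrier_mat N c" "i < 2 * n1 + n3" "j < c"
  shows "(obs_selection * M) $$ (i, j) = M $$ (obs_index i, j)"
  unfolding obs_selection_def
  using index_signed_selection_mult[where f = obs_index and s = "\<lambda>_. 1",
      OF assms(1,2) obs_index_less[OF assms(2)] assms(3)] by simp

lemma index_obs_selection_mult_vec:
  assumes "w \<in> carrier_vec N" "i < 2 * n1 + n3"
  shows "(obs_selection *\<^sub>v w) $ i = w $ obs_index i"
  unfolding obs_selection_def
  using index_signed_selection_mult_vec[where f = obs_index and s = "\<lambda>_. 1",
      OF assms obs_index_less[OF assms(2)]] by simp

lemma index_mult_obs_selection:
  assumes "M \<in> carrier_mat r (2 * n1 + n3)" "i < r" "j < N"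
  shows "(M * obs_selection) $$ (i, j)
    = (if block j = PH \<or> block j = CO then M $$ (i, obs_index_inv j) else 0)"
proof -
  have selected: "j = obs_index k \<longleftrightarrow> k = obs_index_inv j \<and> (block j = PH \<or> block j = CO)"
    if "k < 2 * n1 + n3" for k
    using that block_obs_index obs_index_obs_index_inv obs_index_inv_obs_index by metis
  have "(M * obs_selection) $$ (i, j)
      = (\<Sum>k<2 * n1 + n3. if j = obs_index k then M $$ (i, k) else 0)"
    using assms by (simp add: obs_selection_def scalar_prod_def atLeast0LessThan
        if_distrib[of "\<lambda>x. _ * x"] cong: if_cong)
  also have "\<dots> = (\<Sum>k<2 * n1 + n3. if k = obs_index_inv j
      then (if block j = PH \<or> block j = CO then M $$ (i, obs_index_inv j) else 0) else 0)"
    using selected by (intro sum.cong refl) auto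
  finally show ?thesis
    using obs_index_inv_less by simp
qed

lemma obs_drift_carrier: "obs_drift H \<in> carrier_mat (2 * n1 + n3) (2 * n1 + n3)"
  using carrier_matD(1)[OF JJ_carrier, of n1] by (intro carrier_matI) (simp_all add: obs_drift_def)

text \<open>On \<open>x_co\<close> the matrix \<open>JJ_bar\<close> acts as \<open>JJ n1\<close>,
  and it sends \<open>p_h\<close> rows to minus \<open>q_h\<close> rows. The drift of (ii) is
  therefore the submatrix of \<open>J H\<close> on the selected coordinates.\<close>

lemma index_obs_drift:
  assumes H: "H \<in> carrier_mat N N" "H\<^sup>T = H" "kalman_hamiltonian H"
    and ik: "i < 2 * n1 + n3" "k < 2 * n1 + n3"
  shows "obs_drift H $$ (i, k) = (JJ_bar n1 n2 n3 * cmat H) $$ (obs_index i, obs_index k)"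
proof -
  have H': "cmat H \<in> carrier_mat N N"
    using H by simp
  have dims: "dim_row (JJ n1) = 2 * n1"
    by (rule carrier_matD(1)[OF JJ_carrier])
  have conj: "conj_index (obs_index i) = (if i < n1 then 2 * n3 + (i + n1)
      else if i < 2 * n1 then 2 * n3 + (i - n1) else i - 2 * n1)"
    "conj_sign (obs_index i) = (if i < n1 then 1 else - 1)"
    using ik(1) by (auto simp: obs_index_def conj_index_def conj_sign_def)
  have rhs: "(JJ_bar n1 n2 n3 * cmat H) $$ (obs_index i, obs_index k)
      = (if i < n1 then 1 else - 1) * H $$ (conj_index (obs_index i), obs_index k)"
    using index_JJ_bar_mult[OF H' obs_index_less[OF ik(1)] obs_index_less[OF ik(2)]]
      conj_index_less[OF obs_index_less[OF ik(1)]] obs_index_less[OF ik(2)] H(1)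
    by (simp add: conj(2))
  have lhs: "obs_drift H $$ (i, k)
      = (if i < 2 * n1
         then if k < 2 * n1
           then (JJ n1 * cmat (subblock H (2 * n3) (2 * n3) (2 * n1) (2 * n1))) $$ (i, k)
           else (JJ n1 * cmat ((subblock H n3 (2 * n3) n3 (2 * n1))\<^sup>T)) $$ (i, k - 2 * n1)
         else if k < 2 * n1 then 0 else - H $$ (i - 2 * n1, n3 + (k - 2 * n1)))"
    using ik H(1) by (auto simp: obs_drift_def index_append_rows index_append_cols dims simp del: index_mult_mat(1))
  \<comment> \<open>The zero block of (ii) comes from the vanishing block of \<open>H\<close> in the
    \<open>q_h\<close> rows and \<open>x_co\<close> columns.\<close>
  have zero: "H $$ (i - 2 * n1, 2 * n3 + k) = 0" if "2 * n1 \<le> i" "k < 2 * n1"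
  proof -
    have "i - 2 * n1 < N" "2 * n3 + k < N" "block (i - 2 * n1) = QH" "block (2 * n3 + k) = CO"
      using that ik by (auto simp: block_def)
    then show ?thesis
      using H(3) unfolding kalman_hamiltonian_def by (metis block.distinct)
  qed
  \<comment> \<open>Needed for the upper right block: (ii) uses the transpose of \<open>H12\<close>,
    while \<open>J H\<close> meets the block below the diagonal.\<close>
  have sym: "H $$ (a, b) = H $$ (b, a)" if "a < N" "b < N" for a b
    using H(1) that by (subst H(2)[symmetric]) simp
  have k_less: "n3 + (k - 2 * n1) < N"
    using ik(2) by auto
  consider "i < n1" | "n1 \<le> i" "i < 2 * n1" | "2 * n1 \<le> i"
    by linarith
  then show ?thesis
  proof cases
    case 1
    then show ?thesis
      unfolding lhs rhs conj using ik sym[of "2 * n3 + (i + n1)" "n3 + (k - 2 * n1)", OF _ k_less]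
      by (simp add: index_JJ_mult[where c = "2 * n1"] index_JJ_mult[where c = n3] obs_index_def
          del: index_mult_mat(1) Nat.add_diff_assoc Nat.add_diff_assoc2)
  next
    case 2
    then show ?thesis
      unfolding lhs rhs conj using ik sym[of "2 * n3 + (i - n1)" "n3 + (k - 2 * n1)", OF _ k_less]
      by (simp add: index_JJ_mult[where c = "2 * n1"] index_JJ_mult[where c = n3] obs_index_def
          del: index_mult_mat(1) Nat.add_diff_assoc Nat.add_diff_assoc2)
  next
    case 3
    then show ?thesis
      unfolding lhs rhs conj using ik zero by (simp add: obs_index_def)
  qed
qed

lemma index_obs_output:
  assumes "i < r" "k < 2 * n1 + n3"
  shows "obs_output r G $$ (i, k) = G $$ (i, obs_index k)"
  using assms by (auto simp: obs_output_def index_append_cols obs_index_def)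

text \<open>The \<open>q_h\<close> and \<open>x_cc\<close> coordinates span an invariant subspace on
  which \<open>G\<close> vanishes, and the selection is the quotient map by it.\<close>

lemma unobservable_subspace_kalman_drift:
  assumes H: "H \<in> carrier_mat N N" "H\<^sup>T = H" "kalman_hamiltonian H"
    and G: "G \<in> carrier_mat r N" "kalman_output G"
    and drift: "kalman_drift (JJ_bar n1 n2 n3 * cmat H)"
  shows "unobservable_subspace (JJ_bar n1 n2 n3 * cmat H) G
    = {v \<in> carrier_vec N. obs_selection *\<^sub>v v \<in> unobservable_subspace (obs_drift H) (obs_output r G)}"
proof (rule unobservable_subspace_intertwining[OF _ G(1) obs_drift_carrier])
  let ?A = "JJ_bar n1 n2 n3 * cmat H"
  show A: "?A \<in> carrier_mat N N"
    using H(1) JJ_bar_carrier by (intro mult_carrier_mat) auto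
  show out: "obs_output r G \<in> carrier_mat r (2 * n1 + n3)"
    by (intro carrier_matI) (auto simp: obs_output_def)
  show "obs_selection * ?A = obs_drift H * obs_selection"
  proof (rule eq_matI)
    fix i j assume "i < dim_row (obs_drift H * obs_selection)" "j < dim_col (obs_drift H * obs_selection)"
    then have ij: "i < 2 * n1 + n3" "j < N"
      using obs_drift_carrier[of H] obs_selection_carrier by auto
    have "?A $$ (obs_index i, j) = (obs_drift H * obs_selection) $$ (i, j)"
    proof (cases "block j = PH \<or> block j = CO")
      case True
      then show ?thesis
        unfolding index_mult_obs_selection[OF obs_drift_carrier ij]
        using index_obs_drift[OF H ij(1) obs_index_inv_less] obs_index_obs_index_inv by simp
    next
      case False
      then have "?A $$ (obs_index i, j) = 0"
        using drift block_obs_index[OF ij(1)] obs_index_less[OF ij(1)] ij(2)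
        unfolding kalman_drift_def by (metis block.distinct)
      then show ?thesis
        unfolding index_mult_obs_selection[OF obs_drift_carrier ij] using False by simp
    qed
    then show "(obs_selection * ?A) $$ (i, j) = (obs_drift H * obs_selection) $$ (i, j)"
      using index_obs_selection_mult[OF A ij] by simp
  qed (use A obs_drift_carrier[of H] obs_selection_carrier in auto)
  show "G = obs_output r G * obs_selection"
  proof (rule eq_matI)
    fix i j assume "i < dim_row (obs_output r G * obs_selection)" "j < dim_col (obs_output r G * obs_selection)"
    then have ij: "i < r" "j < N"
      using out obs_selection_carrier by auto
    show "G $$ (i, j) = (obs_output r G * obs_selection) $$ (i, j)"
      unfolding index_mult_obs_selection[OF out ij]
      using G ij index_obs_output[OF ij(1) obs_index_inv_less] obs_index_obs_index_inv
      by (auto simp: kalman_output_def)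
  qed (use out G(1) obs_selection_carrier in auto)
qed (rule obs_selection_carrier)

end

section \<open>Zero patterns of the QSDE coefficients\<close>

lemma doubled_carrier: "\<Gamma> \<in> carrier_mat m n \<Longrightarrow> doubled \<Gamma> \<in> carrier_mat (2 * m) n"
  by (intro carrier_matI) (auto simp: doubled_def)

context block_dimensions
begin

text \<open>Zero columns survive multiplication from the left. Applied with \<open>V_mat\<close> and
  with its adjoint, this gives \<open>qsde_C\<close> and the doubled coupling matrix the same
  pattern.\<close>

lemma kalman_output_mult:
  fixes G :: "'a :: semiring_0 mat"
  assumes "X \<in> carrier_mat q r" "G \<in> carrier_mat r N" "kalman_output G"
  shows "kalman_output (X * G)"
  unfolding kalman_output_def
proof (intro allI impI, rule ccontr)
  fix i j assume ij: "i < dim_row (X * G)" "j < N" and "\<not> (block j = PH \<or> block j = CO)"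
  then have "col G j = 0\<^sub>v r"
    using assms(2,3) by (intro eq_vecI) (auto simp: kalman_output_def)
  moreover assume "(X * G) $$ (i, j) \<noteq> 0"
  ultimately show False
    using ij assms(1,2) by (auto simp: row_def)
qed

text \<open>Conjugation sends the \<open>p_h\<close> and \<open>x_cc\<close> rows of the product to
  the \<open>q_h\<close> and \<open>x_cc\<close> columns of \<open>C\<close>, which are zero;
  \<open>W\<close> only mixes columns.\<close>

lemma kalman_input_of_output:
  assumes C: "C \<in> carrier_mat p N" "kalman_output C" and W: "W \<in> carrier_mat p p"
  shows "kalman_input (JJ_bar n1 n2 n3 * mat_adjoint C * W)"
  unfolding kalman_input_def
proof (intro allI impI, rule ccontr)
  let ?B = "JJ_bar n1 n2 n3 * mat_adjoint C * W"
  fix i j assume ij: "i < N" "j < dim_col ?B" and i: "\<not> (block i = QH \<or> block i = CO)"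
  have j: "j < p"
    using ij W by simp
  have C': "mat_adjoint C * W \<in> carrier_mat N p"
    using C(1) W by (intro mult_carrier_mat) auto
  have "block (conj_index i) \<noteq> PH" "block (conj_index i) \<noteq> CO"
    using i block_conj_index[OF ij(1)] by (cases "block i"; simp)+
  then have "C $$ (k, conj_index i) = 0" if "k < p" for k
    using C that conj_index_less[OF ij(1)] unfolding kalman_output_def by blast
  then have "row (mat_adjoint C) (conj_index i) = 0\<^sub>v p"
    using C(1) conj_index_less[OF ij(1)] by (intro eq_vecI) auto
  then have "(mat_adjoint C * W) $$ (conj_index i, j) = 0"
    using C(1) W j conj_index_less[OF ij(1)] by simp
  moreover have "?B = JJ_bar n1 n2 n3 * (mat_adjoint C * W)"
    using C(1) W by (intro assoc_mult_mat[OF JJ_bar_carrier]) auto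
  then have "?B $$ (i, j) = conj_sign i * (mat_adjoint C * W) $$ (conj_index i, j)"
    using index_JJ_bar_mult[OF C' ij(1) j] by simp
  moreover assume "?B $$ (i, j) \<noteq> 0"
  ultimately show False
    by simp
qed

text \<open>A nonzero entry requires a row in \<open>QH\<close> or \<open>CO\<close> and a column in
  \<open>PH\<close> or \<open>CO\<close>, and every such position is open in the drift
  pattern.\<close>

lemma index_input_mult_output:
  fixes B :: "'a :: semiring_0 mat"
  assumes "B \<in> carrier_mat N p" "C \<in> carrier_mat p N" "kalman_input B" "kalman_output C"
    and ij: "i < N" "j < N"
    and zero: "block i \<noteq> QH" "block j \<noteq> PH" "block i \<noteq> block j"
  shows "(B * C) $$ (i, j) = 0"
proof (cases "block j = CO")
  case True
  then have "row B i = 0\<^sub>v p"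
    using assms by (intro eq_vecI) (auto simp: kalman_input_def)
  then show ?thesis
    using assms(1,2) ij by simp
next
  case False
  then have "col C j = 0\<^sub>v p"
    using assms by (intro eq_vecI) (auto simp: kalman_output_def)
  then show ?thesis
    using assms(1,2) ij by simp
qed

lemma kalman_drift_add_iff:
  fixes A :: "complex mat"
  assumes "A \<in> carrier_mat N N" "B \<in> carrier_mat N p" "C \<in> carrier_mat p N"
    and "kalman_input B" "kalman_output C"
  shows "kalman_drift (A + c \<cdot>\<^sub>m (B * C)) \<longleftrightarrow> kalman_drift A"
proof -
  have "(A + c \<cdot>\<^sub>m (B * C)) $$ (i, j) = A $$ (i, j)"
    if "i < N" "j < N" "block i \<noteq> QH" "block j \<noteq> PH" "block i \<noteq> block j" for i j
    using index_input_mult_output[OF assms(2-5) that] assms(1-3) that(1,2)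
    by (simp del: index_mult_mat(1))
  then show ?thesis
    unfolding kalman_drift_def by metis
qed

lemma kalman_drift_JJ_bar_iff:
  assumes H: "H \<in> carrier_mat N N"
  shows "kalman_drift (JJ_bar n1 n2 n3 * cmat H) \<longleftrightarrow> kalman_hamiltonian H"
proof -
  have H': "cmat H \<in> carrier_mat N N"
    using H by simp
  have nz: "(JJ_bar n1 n2 n3 * cmat H) $$ (i, j) \<noteq> 0 \<longleftrightarrow> H $$ (conj_index i, j) \<noteq> 0"
    if "i < N" "j < N" for i j
    using index_JJ_bar_mult[OF H' that] H that conj_index_less[OF that(1)] by simp
  show ?thesis
  proof
    assume drift: "kalman_drift (JJ_bar n1 n2 n3 * cmat H)"
    show "kalman_hamiltonian H"
      unfolding kalman_hamiltonian_def
    proof (intro allI impI)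
      fix i j assume ij: "i < N" "j < N" "H $$ (i, j) \<noteq> 0"
      let ?i = "conj_index i"
      have "(JJ_bar n1 n2 n3 * cmat H) $$ (?i, j) \<noteq> 0"
        using nz[OF conj_index_less[OF ij(1)] ij(2)] ij(3) conj_index_conj_index[OF ij(1)] by simp
      then have "block ?i = QH \<or> block j = PH \<or> block ?i = block j"
        using drift conj_index_less[OF ij(1)] ij(2) unfolding kalman_drift_def by blast
      then show "block i = PH \<or> block j = PH \<or> block i = block j \<and> block i \<noteq> QH"
        using block_conj_index[OF ij(1)] by (cases "block i") auto
    qed
  next
    assume pattern: "kalman_hamiltonian H"
    show "kalman_drift (JJ_bar n1 n2 n3 * cmat H)"
      unfolding kalman_drift_def
    proof (intro allI impI)
      fix i j assume ij: "i < N" "j < N" "(JJ_bar n1 n2 n3 * cmat H) $$ (i, j) \<noteq> 0"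
      let ?i = "conj_index i"
      have "block ?i = PH \<or> block j = PH \<or> block ?i = block j \<and> block ?i \<noteq> QH"
        using pattern nz[OF ij(1,2)] ij(3) conj_index_less[OF ij(1)] ij(2)
        unfolding kalman_hamiltonian_def by blast
      then show "block i = QH \<or> block j = PH \<or> block i = block j"
        using block_conj_index[OF ij(1)] by (cases "block i") auto
    qed
  qed
qed

lemma qsde_decomposition:
  assumes H: "H \<in> carrier_mat N N" and \<Gamma>: "\<Gamma> \<in> carrier_mat m N"
  shows "qsde_B n1 n2 n3 m \<Gamma> = JJ_bar n1 n2 n3 * mat_adjoint (qsde_C m \<Gamma>) * JJ m"
    and "qsde_A n1 n2 n3 m H \<Gamma>
      = JJ_bar n1 n2 n3 * cmat H + (1 / 2) \<cdot>\<^sub>m (qsde_B n1 n2 n3 m \<Gamma> * qsde_C m \<Gamma>)"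
proof -
  let ?J = "JJ_bar n1 n2 n3" and ?G = "doubled \<Gamma>" and ?V = "V_mat m"
  have G: "?G \<in> carrier_mat (2 * m) N"
    by (rule doubled_carrier[OF \<Gamma>])
  note carriers = JJ_bar_carrier G mat_adjoint_carrier[OF G] V_mat_carrier[of m]
    mat_adjoint_carrier[OF V_mat_carrier[of m]] JJ_carrier[of m] J_mat_carrier[of m]
  have JG: "?J * mat_adjoint ?G \<in> carrier_mat N (2 * m)"
    by (rule mult_carrier_mat[OF carriers(1,3)])
  show B: "qsde_B n1 n2 n3 m \<Gamma> = ?J * mat_adjoint (qsde_C m \<Gamma>) * JJ m"
    unfolding qsde_B_def qsde_C_def mat_adjoint_mult[OF V_mat_carrier G]
      assoc_mult_mat[OF JJ_bar_carrier carriers(3) carriers(5)] ..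
  have JGV: "?J * mat_adjoint ?G * mat_adjoint ?V \<in> carrier_mat N (2 * m)"
    by (rule mult_carrier_mat[OF JG carriers(5)])
  have VJ: "mat_adjoint ?V * JJ m \<in> carrier_mat (2 * m) (2 * m)"
    by (rule mult_carrier_mat[OF carriers(5,6)])
  \<comment> \<open>Rebracketing brings \<open>V\<^sup>\<dagger> JJ V\<close> together in the middle
    of the product.\<close>
  have "qsde_B n1 n2 n3 m \<Gamma> * qsde_C m \<Gamma>
      = ?J * mat_adjoint ?G * (mat_adjoint ?V * JJ m * ?V) * ?G"
    unfolding qsde_B_def qsde_C_def assoc_mult_mat[OF JG carriers(5) carriers(6)]
    unfolding assoc_mult_mat[OF mult_carrier_mat[OF JG VJ] carriers(4) G, symmetric]
      assoc_mult_mat[OF JG VJ carriers(4)] ..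
  also have "\<dots> = (- \<i>) \<cdot>\<^sub>m (?J * mat_adjoint ?G * J_mat m * ?G)"
    unfolding V_mat_conjugates_JJ mult_smult_distrib[OF JG carriers(7)]
      mult_smult_assoc_mat[OF mult_carrier_mat[OF JG carriers(7)] G] ..
  finally have BC: "qsde_B n1 n2 n3 m \<Gamma> * qsde_C m \<Gamma>
      = (- \<i>) \<cdot>\<^sub>m (?J * mat_adjoint ?G * J_mat m * ?G)" .
  define X where "X = ?J * mat_adjoint ?G * J_mat m * ?G"
  have X: "X \<in> carrier_mat N N"
    unfolding X_def by (rule mult_carrier_mat[OF mult_carrier_mat[OF JG carriers(7)] G])
  have JH: "?J * cmat H \<in> carrier_mat N N"
    using H by (intro mult_carrier_mat[OF JJ_bar_carrier]) simp
  show "qsde_A n1 n2 n3 m H \<Gamma> = ?J * cmat H + (1 / 2) \<cdot>\<^sub>m (qsde_B n1 n2 n3 m \<Gamma> * qsde_C m \<Gamma>)"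
    unfolding BC qsde_A_def X_def[symmetric]
    using X JH by (intro eq_matI) (auto simp del: index_mult_mat(1))
qed

section \<open>Coordinate subspaces and the reduced pair\<close>

lemma coord_subspace_unobservable_iff:
  "v \<in> coord_subspace N (idx_qh n3 \<union> idx_cc n1 n2 n3) \<longleftrightarrow>
    v \<in> carrier_vec N \<and> (\<forall>i<N. block i = PH \<or> block i = CO \<longrightarrow> v $ i = 0)"
proof -
  have "i \<notin> idx_qh n3 \<union> idx_cc n1 n2 n3 \<longleftrightarrow> block i = PH \<or> block i = CO" if "i < N" for i
    using that by (auto simp: idx_qh_def idx_cc_def block_def)
  then show ?thesis
    unfolding coord_subspace_def by blast
qed

lemma coord_subspace_uncontrollable_iff:
  "v \<in> coord_subspace N (- (idx_qh n3 \<union> idx_co n1 n3)) \<longleftrightarrow>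
    v \<in> carrier_vec N \<and> (\<forall>i<N. block i = QH \<or> block i = CO \<longrightarrow> v $ i = 0)"
proof -
  have "i \<notin> - (idx_qh n3 \<union> idx_co n1 n3) \<longleftrightarrow> block i = QH \<or> block i = CO" if "i < N" for i
    using that by (auto simp: idx_qh_def idx_co_def block_def)
  then show ?thesis
    unfolding coord_subspace_def by blast
qed

text \<open>The orthogonal complement of the prescribed controllable subspace is spanned by the
  \<open>p_h\<close> and \<open>x_cc\<close> coordinates; conjugation turns these into
  \<open>q_h\<close> and \<open>x_cc\<close>.\<close>

lemma JJ_bar_mult_vec_unobservable_iff:
  assumes w: "w \<in> carrier_vec N"
  shows "JJ_bar n1 n2 n3 *\<^sub>v w \<in> coord_subspace N (idx_qh n3 \<union> idx_cc n1 n2 n3) \<longleftrightarrow>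
    w \<in> coord_subspace N (- (idx_qh n3 \<union> idx_co n1 n3))"
proof -
  have "(\<forall>i<N. block i = PH \<or> block i = CO \<longrightarrow> (JJ_bar n1 n2 n3 *\<^sub>v w) $ i = 0)
      \<longleftrightarrow> (\<forall>i<N. block i = PH \<or> block i = CO \<longrightarrow> w $ conj_index i = 0)"
    by (simp add: index_JJ_bar_mult_vec[OF w])
  also have "\<dots> \<longleftrightarrow> (\<forall>i<N. block i = QH \<or> block i = CO \<longrightarrow> w $ i = 0)"
    using block_conj_index conj_index_less conj_index_conj_index
    by (metis block.simps(13-16))
  finally show ?thesis
    using w mult_mat_vec_carrier[OF JJ_bar_carrier w]
    unfolding coord_subspace_unobservable_iff coord_subspace_uncontrollable_iff by blast
qed

lemma obs_selection_eq_0_iff: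
  assumes "v \<in> carrier_vec N"
  shows "obs_selection *\<^sub>v v = 0\<^sub>v (2 * n1 + n3) \<longleftrightarrow>
    v \<in> coord_subspace N (idx_qh n3 \<union> idx_cc n1 n2 n3)"
proof -
  have "obs_selection *\<^sub>v v = 0\<^sub>v (2 * n1 + n3) \<longleftrightarrow> (\<forall>i<2 * n1 + n3. v $ obs_index i = 0)"
    using index_obs_selection_mult_vec[OF assms] carrier_matD(1)[OF obs_selection_carrier]
    by (auto simp: vec_eq_iff simp del: index_mult_mat_vec)
  also have "\<dots> \<longleftrightarrow> (\<forall>j<N. block j = PH \<or> block j = CO \<longrightarrow> v $ j = 0)"
    using obs_index_less block_obs_index obs_index_obs_index_inv obs_index_inv_less by metis
  finally show ?thesis
    using assms unfolding coord_subspace_unobservable_iff by blast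
qed

lemma obs_selection_surj:
  assumes y: "y \<in> carrier_vec (2 * n1 + n3)"
  obtains v where "v \<in> carrier_vec N" "obs_selection *\<^sub>v v = y"
proof
  \<comment> \<open>The entries at \<open>q_h\<close> and \<open>x_cc\<close> are arbitrary, since
    the selection ignores them.\<close>
  let ?v = "vec N (\<lambda>j. y $ obs_index_inv j)"
  show "?v \<in> carrier_vec N"
    by simp
  then show "obs_selection *\<^sub>v ?v = y"
    using y obs_index_less obs_index_inv_obs_index carrier_matD(1)[OF obs_selection_carrier]
    by (intro eq_vecI) (simp_all add: index_obs_selection_mult_vec del: index_mult_mat_vec)
qed

lemma
  assumes H: "H \<in> carrier_mat N N" "H\<^sup>T = H" and \<Gamma>: "\<Gamma> \<in> carrier_mat m N"
  shows unobservable_subspace_qsde: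
      "unobservable_subspace (qsde_A n1 n2 n3 m H \<Gamma>) (qsde_C m \<Gamma>)
        = unobservable_subspace (JJ_bar n1 n2 n3 * cmat H) (doubled \<Gamma>)"
    and controllable_subspace_qsde:
      "unobservable_subspace (qsde_A n1 n2 n3 m H \<Gamma>) (qsde_C m \<Gamma>)
          = coord_subspace N (idx_qh n3 \<union> idx_cc n1 n2 n3) \<Longrightarrow>
       controllable_subspace (qsde_A n1 n2 n3 m H \<Gamma>) (qsde_B n1 n2 n3 m \<Gamma>)
          = coord_subspace N (idx_qh n3 \<union> idx_co n1 n3)"
proof -
  let ?A = "qsde_A n1 n2 n3 m H \<Gamma>" and ?B = "qsde_B n1 n2 n3 m \<Gamma>" and ?C = "qsde_C m \<Gamma>"
    and ?J = "JJ_bar n1 n2 n3"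
  have G: "doubled \<Gamma> \<in> carrier_mat (2 * m) N"
    by (rule doubled_carrier[OF \<Gamma>])
  have C: "?C \<in> carrier_mat (2 * m) N"
    unfolding qsde_C_def by (rule mult_carrier_mat[OF V_mat_carrier G])
  have H': "cmat H \<in> carrier_mat N N" "mat_adjoint (cmat H) = cmat H"
  proof -
    have "H $$ (j, i) = H $$ (i, j)" if "i < N" "j < N" for i j
      using H(1) that by (subst H(2)[symmetric]) simp
    then show "mat_adjoint (cmat H) = cmat H"
      using H(1) by (intro eq_matI) auto
  qed (use H in simp)
  have JH: "?J * cmat H \<in> carrier_mat N N"
    by (rule mult_carrier_mat[OF JJ_bar_carrier H'(1)])
  \<comment> \<open>\<open>B_eq\<close> is folded before \<open>A_eq\<close>, because the
    decomposition of the drift mentions \<open>qsde_B\<close>.\<close>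
  note B_eq = qsde_decomposition(1)[OF H(1) \<Gamma>] and A_eq = qsde_decomposition(2)[OF H(1) \<Gamma>]
  note dual = unobservable_subspace_adjoint[OF JJ_bar_carrier JJ_bar_adjoint H' C JJ_carrier JJ_unitary,
      folded B_eq, folded A_eq]
  have "unobservable_subspace (?J * cmat H) ?C = unobservable_subspace (?J * cmat H) (doubled \<Gamma>)"
    unfolding qsde_C_def
    using unobservable_subspace_left_inverse[OF JH G V_mat_carrier _ V_mat_unitary] by simp
  then show "unobservable_subspace ?A ?C = unobservable_subspace (?J * cmat H) (doubled \<Gamma>)"
    using dual(1) by simp
  assume unobs: "unobservable_subspace ?A ?C = coord_subspace N (idx_qh n3 \<union> idx_cc n1 n2 n3)"
  have B: "?B \<in> carrier_mat N (2 * m)"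
    unfolding B_eq
    by (rule mult_carrier_mat[OF mult_carrier_mat[OF JJ_bar_carrier mat_adjoint_carrier[OF C]] JJ_carrier])
  have A: "?A \<in> carrier_mat N N"
    unfolding A_eq using JH mult_carrier_mat[OF B C] by auto
  have "unobservable_subspace (mat_adjoint ?A) (mat_adjoint ?B)
      = coord_subspace N (- (idx_qh n3 \<union> idx_co n1 n3))"
    unfolding dual(2) unobs using JJ_bar_mult_vec_unobservable_iff coord_subspace_uncontrollable_iff
    by blast
  then show "controllable_subspace ?A ?B = coord_subspace N (idx_qh n3 \<union> idx_co n1 n3)"
    by (rule controllable_subspace_eq_coord_subspace[OF A B])
qed

text \<open>The selection is onto and its kernel is the prescribed coordinate subspace, so the
  preimage of a subspace equals that kernel exactly when the subspace is trivial.\<close>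

lemma observable_pair_iff:
  assumes H: "H \<in> carrier_mat N N" "H\<^sup>T = H" "kalman_hamiltonian H"
    and \<Gamma>: "\<Gamma> \<in> carrier_mat m N" "kalman_output (doubled \<Gamma>)"
  shows "observable_pair (obs_drift H) (obs_output (2 * m) (doubled \<Gamma>)) \<longleftrightarrow>
    unobservable_subspace (qsde_A n1 n2 n3 m H \<Gamma>) (qsde_C m \<Gamma>)
      = coord_subspace N (idx_qh n3 \<union> idx_cc n1 n2 n3)"
proof -
  let ?U = "unobservable_subspace (obs_drift H) (obs_output (2 * m) (doubled \<Gamma>))"
  let ?W = "coord_subspace N (idx_qh n3 \<union> idx_cc n1 n2 n3)"
  have out: "obs_output (2 * m) (doubled \<Gamma>) \<in> carrier_mat (2 * m) (2 * n1 + n3)"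
    by (intro carrier_matI) (auto simp: obs_output_def)
  have U: "?U \<subseteq> carrier_vec (2 * n1 + n3)" "0\<^sub>v (2 * n1 + n3) \<in> ?U"
  proof -
    show "?U \<subseteq> carrier_vec (2 * n1 + n3)"
      by (rule unobservable_subspace_carrier[OF obs_drift_carrier out])
    show "0\<^sub>v (2 * n1 + n3) \<in> ?U"
      unfolding unobservable_subspace_def
      using mat_kernelI[OF observability_matrix_carrier[OF obs_drift_carrier out]]
        observability_matrix_carrier[OF obs_drift_carrier out] by simp
  qed
  have "kalman_drift (JJ_bar n1 n2 n3 * cmat H)"
    using kalman_drift_JJ_bar_iff H by blast
  then have eq: "unobservable_subspace (qsde_A n1 n2 n3 m H \<Gamma>) (qsde_C m \<Gamma>)
      = {v \<in> carrier_vec N. obs_selection *\<^sub>v v \<in> ?U}"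
    unfolding unobservable_subspace_qsde[OF H(1,2) \<Gamma>(1)]
    by (rule unobservable_subspace_kalman_drift[OF H doubled_carrier[OF \<Gamma>(1)] \<Gamma>(2)])
  have obs: "observable_pair (obs_drift H) (obs_output (2 * m) (doubled \<Gamma>))
      \<longleftrightarrow> ?U = {0\<^sub>v (2 * n1 + n3)}"
    using carrier_matD(1)[OF obs_drift_carrier] by (simp add: observable_pair_def)
  have "?U = {0\<^sub>v (2 * n1 + n3)} \<longleftrightarrow> {v \<in> carrier_vec N. obs_selection *\<^sub>v v \<in> ?U} = ?W"
  proof
    assume "?U = {0\<^sub>v (2 * n1 + n3)}"
    then show "{v \<in> carrier_vec N. obs_selection *\<^sub>v v \<in> ?U} = ?W"
      using obs_selection_eq_0_iff coord_subspace_unobservable_iff by blast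
  next
    assume W: "{v \<in> carrier_vec N. obs_selection *\<^sub>v v \<in> ?U} = ?W"
    have "y = 0\<^sub>v (2 * n1 + n3)" if y: "y \<in> ?U" for y
    proof -
      obtain v where v: "v \<in> carrier_vec N" "obs_selection *\<^sub>v v = y"
        using obs_selection_surj y U(1) by blast
      then have "v \<in> ?W"
        using y W by blast
      then show ?thesis
        using v obs_selection_eq_0_iff[OF v(1)] by blast
    qed
    then show "?U = {0\<^sub>v (2 * n1 + n3)}"
      using U(2) by blast
  qed
  then show ?thesis
    unfolding obs eq .
qed

text \<open>Controllability is absent on the right because duality derives it from the unobservable
  subspace. The input pattern follows from the output pattern, and the latter lets the drift pattern
  be tested on \<open>J H\<close>.\<close>

lemma kalman_canonical_form_qsde_iff:
  assumes H: "H \<in> carrier_mat N N" "H\<^sup>T = H" and \<Gamma>: "\<Gamma> \<in> carrier_mat m N"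
  shows "kalman_canonical_form n1 n2 n3 m
      (qsde_A n1 n2 n3 m H \<Gamma>) (qsde_B n1 n2 n3 m \<Gamma>) (qsde_C m \<Gamma>) \<longleftrightarrow>
    kalman_hamiltonian H \<and> kalman_output (doubled \<Gamma>) \<and>
    observable_pair (obs_drift H) (obs_output (2 * m) (doubled \<Gamma>))"
proof -
  let ?A = "qsde_A n1 n2 n3 m H \<Gamma>" and ?B = "qsde_B n1 n2 n3 m \<Gamma>" and ?C = "qsde_C m \<Gamma>"
  have G: "doubled \<Gamma> \<in> carrier_mat (2 * m) N"
    by (rule doubled_carrier[OF \<Gamma>])
  have C: "?C \<in> carrier_mat (2 * m) N"
    unfolding qsde_C_def by (rule mult_carrier_mat[OF V_mat_carrier G])
  note B_eq = qsde_decomposition(1)[OF H(1) \<Gamma>] and A_eq = qsde_decomposition(2)[OF H(1) \<Gamma>]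
  have B: "?B \<in> carrier_mat N (2 * m)"
    unfolding B_eq
    by (rule mult_carrier_mat[OF mult_carrier_mat[OF JJ_bar_carrier mat_adjoint_carrier[OF C]] JJ_carrier])
  have JH: "JJ_bar n1 n2 n3 * cmat H \<in> carrier_mat N N"
    using H(1) by (intro mult_carrier_mat[OF JJ_bar_carrier]) simp
  have A: "?A \<in> carrier_mat N N"
    unfolding A_eq using JH mult_carrier_mat[OF B C] by auto
  have "doubled \<Gamma> = mat_adjoint (V_mat m) * ?C"
    unfolding qsde_C_def
      assoc_mult_mat[OF mat_adjoint_carrier[OF V_mat_carrier] V_mat_carrier G, symmetric]
      V_mat_unitary left_mult_one_mat[OF G] ..
  then have output_iff: "kalman_output ?C \<longleftrightarrow> kalman_output (doubled \<Gamma>)"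
    using kalman_output_mult[OF V_mat_carrier G]
      kalman_output_mult[OF mat_adjoint_carrier[OF V_mat_carrier] C] by (metis qsde_C_def)
  have input: "kalman_input ?B" if "kalman_output ?C"
    unfolding B_eq by (rule kalman_input_of_output[OF C that JJ_carrier])
  have drift: "kalman_drift ?A \<longleftrightarrow> kalman_hamiltonian H" if "kalman_output ?C"
    using kalman_drift_add_iff[OF JH B C input[OF that] that] kalman_drift_JJ_bar_iff[OF H(1)]
    unfolding A_eq by simp
  show ?thesis
    unfolding kalman_canonical_form_iff[OF A B C]
    using output_iff input drift observable_pair_iff[OF H _ \<Gamma>] controllable_subspace_qsde[OF H \<Gamma>]
    by blast
qed

end

theorem theorem3p2:
  fixes n1 n2 n3 m :: nat and H :: "real mat" and \<Gamma> :: "complex mat"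
  assumes "H \<in> carrier_mat (2 * (n1 + n2 + n3)) (2 * (n1 + n2 + n3))"
    and "\<Gamma> \<in> carrier_mat m (2 * (n1 + n2 + n3))"
  shows
    "(\<forall>Hh12 Hh22 H12 H13 Hco Hcc \<Gamma>h \<Gamma>co.
        hamiltonian_coupling_block_form n1 n2 n3 m H \<Gamma> Hh12 Hh22 H12 H13 Hco Hcc \<Gamma>h \<Gamma>co \<and>
        Hh22 = Hh22\<^sup>T \<and> Hco = Hco\<^sup>T \<and> Hcc = Hcc\<^sup>T \<and>
        observable_pair
          (JJ n1 * cmat Hco @\<^sub>c JJ n1 * cmat (H12\<^sup>T)
           @\<^sub>r 0\<^sub>m n3 (2 * n1) @\<^sub>c - cmat Hh12)
          (\<Gamma>co @\<^sub>c \<Gamma>h)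
        \<longrightarrow> kalman_canonical_form n1 n2 n3 m
              (qsde_A n1 n2 n3 m H \<Gamma>) (qsde_B n1 n2 n3 m \<Gamma>) (qsde_C m \<Gamma>))
     \<and>
     (H\<^sup>T = H \<and>
      kalman_canonical_form n1 n2 n3 m
        (qsde_A n1 n2 n3 m H \<Gamma>) (qsde_B n1 n2 n3 m \<Gamma>) (qsde_C m \<Gamma>)
      \<longrightarrow> (\<exists>Hh12 Hh22 H12 H13 Hco Hcc \<Gamma>h \<Gamma>co.
        hamiltonian_coupling_block_form n1 n2 n3 m H \<Gamma> Hh12 Hh22 H12 H13 Hco Hcc \<Gamma>h \<Gamma>co \<and>
        Hh22 = Hh22\<^sup>T \<and> Hco = Hco\<^sup>T \<and> Hcc = Hcc\<^sup>T \<and>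
        observable_pair
          (JJ n1 * cmat Hco @\<^sub>c JJ n1 * cmat (H12\<^sup>T)
           @\<^sub>r 0\<^sub>m n3 (2 * n1) @\<^sub>c - cmat Hh12)
          (\<Gamma>co @\<^sub>c \<Gamma>h)))"
proof (rule conjI)
  interpret block_dimensions n1 n2 n3 .
  show "\<forall>Hh12 Hh22 H12 H13 Hco Hcc \<Gamma>h \<Gamma>co.
        hamiltonian_coupling_block_form n1 n2 n3 m H \<Gamma> Hh12 Hh22 H12 H13 Hco Hcc \<Gamma>h \<Gamma>co \<and>
        Hh22 = Hh22\<^sup>T \<and> Hco = Hco\<^sup>T \<and> Hcc = Hcc\<^sup>T \<and>
        observable_pair
          (JJ n1 * cmat Hco @\<^sub>c JJ n1 * cmat (H12\<^sup>T)
           @\<^sub>r 0\<^sub>m n3 (2 * n1) @\<^sub>c - cmat Hh12)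
          (\<Gamma>co @\<^sub>c \<Gamma>h)
        \<longrightarrow> kalman_canonical_form n1 n2 n3 m
              (qsde_A n1 n2 n3 m H \<Gamma>) (qsde_B n1 n2 n3 m \<Gamma>) (qsde_C m \<Gamma>)"
  proof (intro allI impI, elim conjE)
    fix Hh12 Hh22 H12 H13 Hco Hcc \<Gamma>h \<Gamma>co
    assume form: "hamiltonian_coupling_block_form n1 n2 n3 m H \<Gamma> Hh12 Hh22 H12 H13 Hco Hcc \<Gamma>h \<Gamma>co"
      and sym: "Hh22 = Hh22\<^sup>T" "Hco = Hco\<^sup>T" "Hcc = Hcc\<^sup>T"
      and obs: "observable_pair
          (JJ n1 * cmat Hco @\<^sub>c JJ n1 * cmat (H12\<^sup>T)
           @\<^sub>r 0\<^sub>m n3 (2 * n1) @\<^sub>c - cmat Hh12)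
          (\<Gamma>co @\<^sub>c \<Gamma>h)"
    \<comment> \<open>In this direction the symmetry of \<open>H\<close> is a consequence of the
      block form and (i).\<close>
    note D = hamiltonian_coupling_block_formD[OF form sym]
    have "observable_pair (obs_drift H) (obs_output (2 * m) (doubled \<Gamma>))"
      using obs unfolding obs_drift_def obs_output_def D(4-8) .
    then show "kalman_canonical_form n1 n2 n3 m
        (qsde_A n1 n2 n3 m H \<Gamma>) (qsde_B n1 n2 n3 m \<Gamma>) (qsde_C m \<Gamma>)"
      using kalman_canonical_form_qsde_iff[OF assms(1) D(1) assms(2)] D(2,3) by blast
  qed
  show "H\<^sup>T = H \<and>
      kalman_canonical_form n1 n2 n3 m
        (qsde_A n1 n2 n3 m H \<Gamma>) (qsde_B n1 n2 n3 m \<Gamma>) (qsde_C m \<Gamma>)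
      \<longrightarrow> (\<exists>Hh12 Hh22 H12 H13 Hco Hcc \<Gamma>h \<Gamma>co.
        hamiltonian_coupling_block_form n1 n2 n3 m H \<Gamma> Hh12 Hh22 H12 H13 Hco Hcc \<Gamma>h \<Gamma>co \<and>
        Hh22 = Hh22\<^sup>T \<and> Hco = Hco\<^sup>T \<and> Hcc = Hcc\<^sup>T \<and>
        observable_pair
          (JJ n1 * cmat Hco @\<^sub>c JJ n1 * cmat (H12\<^sup>T)
           @\<^sub>r 0\<^sub>m n3 (2 * n1) @\<^sub>c - cmat Hh12)
          (\<Gamma>co @\<^sub>c \<Gamma>h))"
  proof (intro impI, elim conjE)
    assume sym: "H\<^sup>T = H" and "kalman_canonical_form n1 n2 n3 m
        (qsde_A n1 n2 n3 m H \<Gamma>) (qsde_B n1 n2 n3 m \<Gamma>) (qsde_C m \<Gamma>)"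
    then have H: "kalman_hamiltonian H" and \<Gamma>: "kalman_output (doubled \<Gamma>)"
      and obs: "observable_pair (obs_drift H) (obs_output (2 * m) (doubled \<Gamma>))"
      using kalman_canonical_form_qsde_iff[OF assms(1) sym assms(2)] by blast+
    \<comment> \<open>The witnesses are the subblocks of \<open>H\<close> and of the doubled
      coupling matrix, the same ones from which \<open>obs_drift\<close> and
      \<open>obs_output\<close> are built.\<close>
    note I = hamiltonian_coupling_block_formI[OF assms(1) doubled_carrier[OF assms(2)] sym H \<Gamma>]
    show "\<exists>Hh12 Hh22 H12 H13 Hco Hcc \<Gamma>h \<Gamma>co.
        hamiltonian_coupling_block_form n1 n2 n3 m H \<Gamma> Hh12 Hh22 H12 H13 Hco Hcc \<Gamma>h \<Gamma>co \<and>
        Hh22 = Hh22\<^sup>T \<and> Hco = Hco\<^sup>T \<and> Hcc = Hcc\<^sup>T \<and>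
        observable_pair
          (JJ n1 * cmat Hco @\<^sub>c JJ n1 * cmat (H12\<^sup>T)
           @\<^sub>r 0\<^sub>m n3 (2 * n1) @\<^sub>c - cmat Hh12)
          (\<Gamma>co @\<^sub>c \<Gamma>h)"
      using I obs unfolding obs_drift_def obs_output_def by blast
  qed
qed

end
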